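(* Consider the projective space $\mathbb{R}P^3=S^3/\mathbb{Z}_2$ with the metric $$A_1^2(t)(e^1)^2+A_2^2(t)\big((e^2)^2+(e^3)^2\big)$$ associated with the three contact $1$-forms $\varepsilon^1=A_1(t)e^1$, $\varepsilon^2=A_2(t)e^2$, $\varepsilon^3=A_2(t)e^3$, which change under the action of the flow $$(\ast\psi)'=\bar d\psi$$ (for $\psi=\varepsilon^1,\varepsilon^2,\varepsilon^3$). Then for appropriate initial data the metric $$dt^2+A_1^2(t)(e^1)^2+A_2^2(t)\big((e^2)^2+(e^3)^2\big)$$ is isometric to the Eguchi--Hanson metric.
   Context: $S^3=Sp(1)$ is the group of unit quaternions, and $e^1,e^2,e^3$ are the $1$-forms dual to the three invariant vector fields on $S^3$ extending the basis $i,j,k$ of $T_1Sp(1)$, with sign convention $de^1=2e^2\wedge e^3$, $de^2=2e^3\wedge e^1$, $de^3=2e^1\wedge e^2$; they descend to $\mathbb{R}P^3=S^3/\{\pm1\}$. $A_1,A_2$ are functions of $t$. A $1$-form $\psi$ on a $(2n+1)$-dimensional manifold is a contact form if $\psi\wedge(d\psi)^n\neq0$ (here $n=1$). $\bar d$ is the exterior differential on the $3$-dimensional manifold, not involving $t$. $\ast$ is the Hodge operator with respect to the orthonormal coframe $\{\varepsilon^1,\varepsilon^2,\varepsilon^3\}$: $\ast\varepsilon^1=\varepsilon^2\wedge\varepsilon^3$, $\ast\varepsilon^2=\varepsilon^3\wedge\varepsilon^1$, $\ast\varepsilon^3=\varepsilon^1\wedge\varepsilon^2$. The prime denotes the derivative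 in $t$, the forms $e^i$ being independent of $t$. The Eguchi--Hanson metric (with parameter $a$) is $$ds^2=\big[1-(a/r)^4\big]^{-1}dr^2+r^2\big((e^2)^2+(e^3)^2\big)+r^2\big[1-(a/r)^4\big](e^1)^2 .$$ *)

theory Defs
  imports "HOL-Analysis.Analysis"
begin

section \<open>Unit quaternions and invariant vector fields\<close>

text \<open>The quaternion \<open>a + b i + c j + d k\<close> is the vector with components \<open>a, b, c, d\<close>
  (indices 1 to 4).\<close>

type_synonym quat = "real ^ 4"

definition qmul :: "quat \<Rightarrow> quat \<Rightarrow> quat" where
  "qmul x y = vector
    [x$1 * y$1 - x$2 * y$2 - x$3 * y$3 - x$4 * y$4,
     x$1 * y$2 + x$2 * y$1 + x$3 * y$4 - x$4 * y$3,
     x$1 * y$3 - x$2 * y$4 + x$3 * y$1 + x$4 * y$2,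
     x$1 * y$4 + x$2 * y$3 - x$3 * y$2 + x$4 * y$1]"

definition qunit :: "3 \<Rightarrow> quat" where
  "qunit i = (if i = 1 then axis 2 1 else if i = 2 then axis 3 1 else axis 4 1)"

definition S3 :: "quat set" where
  "S3 = sphere 0 1"

text \<open>These are the right-invariant fields. The left-invariant fields \<open>x \<mapsto> x i\<close>, etc., would
  give \<open>de\<^sup>1 = - 2 e\<^sup>2 \<and> e\<^sup>3\<close>; with the right-invariant ones the convention
  \<open>de\<^sup>1 = 2 e\<^sup>2 \<and> e\<^sup>3\<close> is a theorem, see \<open>ext_deriv_coform\<close> below.\<close>

definition frame :: "3 \<Rightarrow> quat \<Rightarrow> quat" where
  "frame i x = qmul (qunit i) x"

section \<open>Projective space, its tangent bundle and forms\<close>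

text \<open>Both $\mathbb{R}P^3$ and its tangent bundle are quotients by the antipodal map, which acts on
  tangent vectors by its differential. The base point of a tangent vector \<open>X\<close> of the quotient is
  \<open>fst ` X\<close>, so \<open>k\<close>-forms are functions of \<open>k\<close> elements of \<open>TRP3\<close> with a common base point; their
  values elsewhere are irrelevant.\<close>

type_synonym tangent = "(quat \<times> quat) set"

definition antipodal :: "(quat \<times> quat) set" where
  "antipodal = {(x, y). x \<in> S3 \<and> (y = x \<or> y = - x)}"

definition RP3 :: "quat set set" where
  "RP3 = S3 // antipodal"

definition proj :: "quat \<Rightarrow> quat set" where
  "proj x = antipodal `` {x}"

definition TS3 :: "(quat \<times> quat) set" where
  "TS3 = {(x, v). x \<in> S3 \<and> x \<bullet> v = 0}"

definition antipodal_T :: "((quat \<times> quat) \<times> (quat \<times> quat)) set" where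
  "antipodal_T = {(a, b). a \<in> TS3 \<and> (b = a \<or> b = - a)}"

definition TRP3 :: "tangent set" where
  "TRP3 = TS3 // antipodal_T"

definition tproj :: "quat \<Rightarrow> quat \<Rightarrow> tangent" where
  "tproj x v = antipodal_T `` {(x, v)}"

definition tangent_space :: "quat set \<Rightarrow> tangent set" where
  "tangent_space p = {X \<in> TRP3. fst ` X = p}"

type_synonym form1 = "tangent \<Rightarrow> real"
type_synonym form2 = "tangent \<Rightarrow> tangent \<Rightarrow> real"
type_synonym form3 = "tangent \<Rightarrow> tangent \<Rightarrow> tangent \<Rightarrow> real"

text \<open>The forms on $\mathbb{R}P^3$ induced by antipodally invariant forms on the sphere.\<close>

definition descend1 :: "(quat \<Rightarrow> quat \<Rightarrow> real) \<Rightarrow> form1" where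
  "descend1 \<omega> X = (THE r. \<exists>x v. (x, v) \<in> X \<and> r = \<omega> x v)"

definition descend2 :: "(quat \<Rightarrow> quat \<Rightarrow> quat \<Rightarrow> real) \<Rightarrow> form2" where
  "descend2 \<omega> X Y = (THE r. \<exists>x v w. (x, v) \<in> X \<and> (x, w) \<in> Y \<and> r = \<omega> x v w)"

text \<open>The three fields \<open>frame i x\<close> are orthonormal (\<open>frame_orthonormal\<close>), so the inner products
  are the dual forms.\<close>

definition coform :: "3 \<Rightarrow> form1" where
  "coform i = descend1 (\<lambda>x v. frame i x \<bullet> v)"

definition wedge11 :: "form1 \<Rightarrow> form1 \<Rightarrow> form2" where
  "wedge11 \<alpha> \<beta> X Y = \<alpha> X * \<beta> Y - \<alpha> Y * \<beta> X"

definition wedge12 :: "form1 \<Rightarrow> form2 \<Rightarrow> form3" where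
  "wedge12 \<alpha> \<beta> X Y Z = \<alpha> X * \<beta> Y Z + \<alpha> Y * \<beta> Z X + \<alpha> Z * \<beta> X Y"

text \<open>The exterior derivative \<open>ext_deriv\<close> of a form \<open>\<psi>\<close> on $\mathbb{R}P^3$ is computed by pulling \<open>\<psi>\<close>
  back to \<open>quat - {0}\<close> along \<open>y \<mapsto> proj (y / norm y)\<close> (in the library \<open>sgn y\<close> is \<open>y / norm y\<close>),
  differentiating there, and restricting to the sphere. This is correct since \<open>d\<close> commutes with
  pullbacks and \<open>sgn\<close> is the identity on the sphere.\<close>

definition euclid_ext_deriv ::
    "('a::real_normed_vector \<Rightarrow> 'a \<Rightarrow> real) \<Rightarrow> 'a \<Rightarrow> 'a \<Rightarrow> 'a \<Rightarrow> real" where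
  "euclid_ext_deriv \<eta> x v w =
     frechet_derivative (\<lambda>y. \<eta> y w) (at x) v - frechet_derivative (\<lambda>y. \<eta> y v) (at x) w"

definition radial_pullback :: "form1 \<Rightarrow> quat \<Rightarrow> quat \<Rightarrow> real" where
  "radial_pullback \<psi> y v = \<psi> (tproj (sgn y) (frechet_derivative sgn (at y) v))"

definition ext_deriv :: "form1 \<Rightarrow> form2" where
  "ext_deriv \<psi> = descend2 (euclid_ext_deriv (radial_pullback \<psi>))"

definition contact_form :: "form1 \<Rightarrow> bool" where
  "contact_form \<psi> \<longleftrightarrow> (\<forall>p\<in>RP3. \<exists>X\<in>tangent_space p. \<exists>Y\<in>tangent_space p. \<exists>Z\<in>tangent_space p.
     wedge12 \<psi> (ext_deriv \<psi>) X Y Z \<noteq> 0)"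

text \<open>The Hodge operator on 1-forms of the metric and orientation for which the coframe \<open>\<epsilon>\<close> is
  oriented orthonormal. Indices in type \<open>3\<close> are cyclic. The vector of coefficients \<open>c\<close> is that of
  \<open>\<psi>\<close> at the base point of \<open>X\<close>; see \<open>hodge_coframe\<close>.\<close>

definition hodge :: "(3 \<Rightarrow> form1) \<Rightarrow> form1 \<Rightarrow> form2" where
  "hodge \<epsilon> \<psi> X Y =
     (let c = (THE c :: real ^ 3. \<forall>Z\<in>tangent_space (fst ` X). \<psi> Z = (\<Sum>i\<in>UNIV. c $ i * \<epsilon> i Z))
      in \<Sum>i\<in>UNIV. c $ i * wedge11 (\<epsilon> (i + 1)) (\<epsilon> (i + 2)) X Y)"

section \<open>The flow\<close>

definition coframe :: "(real \<Rightarrow> real) \<Rightarrow> (real \<Rightarrow> real) \<Rightarrow> real \<Rightarrow> 3 \<Rightarrow> form1" where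
  "coframe A1 A2 t i X = (if i = 1 then A1 t else A2 t) * coform i X"

definition contact_flow :: "real set \<Rightarrow> (real \<Rightarrow> real) \<Rightarrow> (real \<Rightarrow> real) \<Rightarrow> bool" where
  "contact_flow T A1 A2 \<longleftrightarrow> (\<forall>t\<in>T. \<forall>i.
     contact_form (coframe A1 A2 t i) \<and>
     (\<forall>p\<in>RP3. \<forall>X\<in>tangent_space p. \<forall>Y\<in>tangent_space p.
        ((\<lambda>s. hodge (coframe A1 A2 s) (coframe A1 A2 s i) X Y) has_real_derivative
           ext_deriv (coframe A1 A2 t i) X Y) (at t)))"

text \<open>Initial data are prescribed at \<open>t = 0\<close>, where one of the forms may vanish (this happens at the
  exceptional 2-sphere of the Eguchi--Hanson space). The flow equation and the contact condition
  are therefore imposed for \<open>t > 0\<close> only, with continuity at \<open>t = 0\<close>.\<close>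

definition flow_solution :: "real \<Rightarrow> real \<Rightarrow> (real \<Rightarrow> real) \<Rightarrow> (real \<Rightarrow> real) \<Rightarrow> bool" where
  "flow_solution c1 c2 A1 A2 \<longleftrightarrow>
     continuous_on {0..} A1 \<and> continuous_on {0..} A2 \<and> A1 0 = c1 \<and> A2 0 = c2 \<and>
     contact_flow {0<..} A1 A2"

section \<open>Metrics on the product of an interval with projective space\<close>

text \<open>A metric takes the interval coordinate of the base point and two tangent vectors \<open>(\<tau>, X)\<close>;
  the other coordinate of the base point is contained in \<open>X\<close>.\<close>

type_synonym metric = "real \<Rightarrow> real \<times> tangent \<Rightarrow> real \<times> tangent \<Rightarrow> real"

definition RP3_metric :: "(real \<Rightarrow> real) \<Rightarrow> (real \<Rightarrow> real) \<Rightarrow> real \<Rightarrow> tangent \<Rightarrow> tangent \<Rightarrow> real" where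
  "RP3_metric A1 A2 t X Y =
     (A1 t)\<^sup>2 * (coform 1 X * coform 1 Y)
     + (A2 t)\<^sup>2 * (coform 2 X * coform 2 Y + coform 3 X * coform 3 Y)"

definition flow_metric :: "(real \<Rightarrow> real) \<Rightarrow> (real \<Rightarrow> real) \<Rightarrow> metric" where
  "flow_metric A1 A2 t = (\<lambda>(\<tau>, X) (\<sigma>, Y). \<tau> * \<sigma> + RP3_metric A1 A2 t X Y)"

definition eguchi_hanson :: "real \<Rightarrow> metric" where
  "eguchi_hanson a r = (\<lambda>(\<tau>, X) (\<sigma>, Y).
     inverse (1 - (a / r) ^ 4) * (\<tau> * \<sigma>)
     + r\<^sup>2 * (coform 2 X * coform 2 Y + coform 3 X * coform 3 Y)
     + r\<^sup>2 * (1 - (a / r) ^ 4) * (coform 1 X * coform 1 Y))"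

text \<open>\<open>Ck_on k W f\<close>: \<open>f\<close> is \<open>k\<close> times continuously differentiable on the open set \<open>W\<close> (for a
  finite-dimensional domain, it is enough to look at directional derivatives).\<close>

primrec Ck_on ::
    "nat \<Rightarrow> 'a::euclidean_space set \<Rightarrow> ('a \<Rightarrow> 'b::real_normed_vector) \<Rightarrow> bool" where
  "Ck_on 0 W f \<longleftrightarrow> continuous_on W f"
| "Ck_on (Suc k) W f \<longleftrightarrow>
     f differentiable_on W \<and> (\<forall>v. Ck_on k W (\<lambda>x. frechet_derivative f (at x) v))"

definition smooth_on ::
    "'a::euclidean_space set \<Rightarrow> ('a \<Rightarrow> 'b::real_normed_vector) \<Rightarrow> bool" where
  "smooth_on W f \<longleftrightarrow> (\<forall>k. Ck_on k W f)"

text \<open>Smoothness of \<open>F : I \<times> RP3 \<rightarrow> J \<times> RP3\<close> (with \<open>I\<close>, \<open>J\<close> open intervals) means that \<open>F\<close> is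
  locally covered by smooth maps \<open>I \<times> S3 \<rightarrow> J \<times> S3\<close>, and these are locally restrictions of smooth
  maps of the ambient space.\<close>

definition local_lift :: "real set \<Rightarrow> real set \<Rightarrow> (real \<times> quat set \<Rightarrow> real \<times> quat set) \<Rightarrow>
    (real \<times> quat) set \<Rightarrow> (real \<times> quat \<Rightarrow> real \<times> quat) \<Rightarrow> bool" where
  "local_lift I J F W G \<longleftrightarrow> open W \<and> smooth_on W G \<and>
     (\<forall>(t, x) \<in> W \<inter> (I \<times> S3).
        G (t, x) \<in> J \<times> S3 \<and> F (t, proj x) = (fst (G (t, x)), proj (snd (G (t, x)))))"

definition smooth_map ::
    "real set \<Rightarrow> real set \<Rightarrow> (real \<times> quat set \<Rightarrow> real \<times> quat set) \<Rightarrow> bool" where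
  "smooth_map I J F \<longleftrightarrow> (\<forall>z \<in> I \<times> S3. \<exists>W G. z \<in> W \<and> local_lift I J F W G)"

definition diffeomorphism ::
    "real set \<Rightarrow> real set \<Rightarrow> (real \<times> quat set \<Rightarrow> real \<times> quat set) \<Rightarrow> bool" where
  "diffeomorphism I J F \<longleftrightarrow> bij_betw F (I \<times> RP3) (J \<times> RP3) \<and>
     smooth_map I J F \<and> smooth_map J I (the_inv_into (I \<times> RP3) F)"

text \<open>The differential of \<open>F\<close> at a tangent vector \<open>(\<tau>, X)\<close> with interval coordinate \<open>t\<close> of the base
  point, computed with any local lift and any representative of \<open>X\<close>.\<close>

definition differential :: "real set \<Rightarrow> real set \<Rightarrow> (real \<times> quat set \<Rightarrow> real \<times> quat set) \<Rightarrow>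
    real \<Rightarrow> real \<times> tangent \<Rightarrow> real \<times> tangent" where
  "differential I J F t = (\<lambda>(\<tau>, X). THE U. \<exists>W G x v.
     local_lift I J F W G \<and> (t, x) \<in> W \<and> (x, v) \<in> X \<and>
     (let D = frechet_derivative G (at (t, x)) (\<tau>, v)
      in U = (fst D, tproj (snd (G (t, x))) (snd D))))"

definition isometric :: "real set \<Rightarrow> metric \<Rightarrow> real set \<Rightarrow> metric \<Rightarrow> bool" where
  "isometric I g J h \<longleftrightarrow> (\<exists>F. diffeomorphism I J F \<and>
     (\<forall>t\<in>I. \<forall>p\<in>RP3. \<forall>X\<in>tangent_space p. \<forall>Y\<in>tangent_space p. \<forall>\<tau> \<sigma>.
        h (fst (F (t, p))) (differential I J F t (\<tau>, X)) (differential I J F t (\<sigma>, Y))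
          = g t (\<tau>, X) (\<sigma>, Y)))"

section \<open>Consistency of the conventions\<close>

lemma exhaust_4: "(i::4) = 1 \<or> i = 2 \<or> i = 3 \<or> i = 4"
proof (induct i)
  case (of_int z)
  then have "0 \<le> z" and "z < 4" by simp_all
  then have "z = 0 \<or> z = 1 \<or> z = 2 \<or> z = 3" by arith
  then show ?case by auto
qed

lemma UNIV_4: "UNIV = {1::4, 2, 3, 4}"
  using exhaust_4 by auto

lemma sum_4: "sum f (UNIV::4 set) = f 1 + f 2 + f 3 + f 4"
  unfolding UNIV_4 by (simp add: ac_simps)

lemma vector_4:
  "(vector [a, b, c, d] :: ('a::zero) ^ 4) $ 1 = a"
  "(vector [a, b, c, d] :: ('a::zero) ^ 4) $ 2 = b"
  "(vector [a, b, c, d] :: ('a::zero) ^ 4) $ 3 = c"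
  "(vector [a, b, c, d] :: ('a::zero) ^ 4) $ 4 = d"
  unfolding vector_def by simp_all

lemma qmul_nth:
  "qmul x y $ 1 = x$1 * y$1 - x$2 * y$2 - x$3 * y$3 - x$4 * y$4"
  "qmul x y $ 2 = x$1 * y$2 + x$2 * y$1 + x$3 * y$4 - x$4 * y$3"
  "qmul x y $ 3 = x$1 * y$3 - x$2 * y$4 + x$3 * y$1 + x$4 * y$2"
  "qmul x y $ 4 = x$1 * y$4 + x$2 * y$3 - x$3 * y$2 + x$4 * y$1"
  unfolding qmul_def vector_4 by simp_all

lemma frame_nth:
  "frame 1 x $ 1 = - x$2" "frame 1 x $ 2 = x$1" "frame 1 x $ 3 = - x$4" "frame 1 x $ 4 = x$3"
  "frame 2 x $ 1 = - x$3" "frame 2 x $ 2 = x$4" "frame 2 x $ 3 = x$1" "frame 2 x $ 4 = - x$2"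
  "frame 3 x $ 1 = - x$4" "frame 3 x $ 2 = - x$3" "frame 3 x $ 3 = x$2" "frame 3 x $ 4 = x$1"
  by (simp_all add: frame_def qmul_nth qunit_def axis_def)

lemma inner_4: "x \<bullet> y = x$1 * y$1 + x$2 * y$2 + x$3 * y$3 + x$4 * (y$4)" for x y :: quat
  by (simp add: inner_vec_def sum_4)

lemma cyclic_3: "(4::3) = 1" "(5::3) = 2"
  by simp_all

lemma vec4_eq_iff: "x = y \<longleftrightarrow> x$1 = y$1 \<and> x$2 = y$2 \<and> x$3 = y$3 \<and> x$4 = (y::quat)$4"
  unfolding vec_eq_iff by (metis exhaust_4)

lemma linear_frame: "linear (frame i)"
  by (rule linearI; use exhaust_3[of i] in
      \<open>auto simp: vec4_eq_iff frame_nth algebra_simps\<close>)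

lemma frame_minus: "frame i (- x) = - frame i x"
  by (simp add: linear_frame linear_neg)

lemma S3_iff: "x \<in> S3 \<longleftrightarrow> x \<bullet> x = 1"
  by (simp add: S3_def norm_eq_1)

lemma frame_orthonormal:
  assumes "x \<in> S3"
  shows "frame i x \<bullet> frame j x = (if i = j then 1 else 0)" and "x \<bullet> frame i x = 0"
  using assms exhaust_3[of i] exhaust_3[of j]
  by (auto simp: S3_iff inner_4 frame_nth algebra_simps)

lemma tproj_eq: "(x, v) \<in> TS3 \<Longrightarrow> tproj x v = {(x, v), (- x, - v)}"
  by (auto simp: tproj_def antipodal_T_def)

lemma TS3_iff: "(x, v) \<in> TS3 \<longleftrightarrow> x \<in> S3 \<and> x \<bullet> v = 0"
  by (simp add: TS3_def)

lemma S3_minus: "- x \<in> S3 \<longleftrightarrow> x \<in> S3"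
  by (simp add: S3_iff)

lemma S3_neq: "x \<in> S3 \<Longrightarrow> - x \<noteq> x"
  by (auto simp: S3_iff neg_eq_iff_add_eq_0 simp flip: scaleR_2)

lemma proj_eq: "x \<in> S3 \<Longrightarrow> proj x = {x, - x}"
  by (auto simp: proj_def antipodal_def)

lemma tangent_space_proj:
  assumes "x \<in> S3"
  shows "tangent_space (proj x) = {tproj x v |v. x \<bullet> v = 0}"
proof (intro set_eqI iffI)
  fix X assume "X \<in> tangent_space (proj x)"
  then have X: "X \<in> TRP3" "fst ` X = {x, - x}"
    by (auto simp: tangent_space_def proj_eq assms)
  from X(1) obtain y v where yv: "(y, v) \<in> TS3" "X = tproj y v"
    by (auto simp: TRP3_def quotient_def tproj_def)
  then have "{y, - y} = {x, - x}"
    using X(2) by (simp add: tproj_eq)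
  then have "y = x \<or> y = - x" by (auto simp: doubleton_eq_iff)
  then show "X \<in> {tproj x v |v. x \<bullet> v = 0}"
  proof
    assume "y = x" then show ?thesis using yv by (auto simp: TS3_iff)
  next
    assume y: "y = - x"
    then have "X = tproj x (- v)" "x \<bullet> (- v) = 0"
      using yv assms by (auto simp: TS3_iff tproj_eq)
    then show ?thesis by blast
  qed
next
  fix X assume "X \<in> {tproj x v |v. x \<bullet> v = 0}"
  then obtain v where v: "X = tproj x v" "(x, v) \<in> TS3"
    using assms by (auto simp: TS3_iff)
  then have "X \<in> TRP3" by (auto simp: TRP3_def quotient_def tproj_def)
  moreover have "fst ` X = proj x" using v assms by (simp add: tproj_eq proj_eq)
  ultimately show "X \<in> tangent_space (proj x)" by (simp add: tangent_space_def)
qed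

lemma coform_tproj: "(x, v) \<in> TS3 \<Longrightarrow> coform i (tproj x v) = frame i x \<bullet> v"
  unfolding coform_def descend1_def by (rule the_equality) (auto simp: tproj_eq frame_minus)

lemma descend2_tproj:
  assumes "(x, v) \<in> TS3" "(x, w) \<in> TS3" "\<omega> (- x) (- v) (- w) = \<omega> x v w"
  shows "descend2 \<omega> (tproj x v) (tproj x w) = \<omega> x v w"
proof -
  have "- x \<noteq> x" using assms(1) S3_neq by (simp add: TS3_iff)
  then show ?thesis
    unfolding descend2_def
    by (intro the_equality) (use assms in \<open>auto simp: tproj_eq\<close>)
qed

lemma frame_skew: "frame i x \<bullet> y = - (x \<bullet> frame i y)"
  using exhaust_3[of i] by (auto simp: inner_4 frame_nth algebra_simps)

lemma frame_wedge:
  assumes "x \<in> S3" "x \<bullet> v = 0" "x \<bullet> w = 0"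
  shows "frame i v \<bullet> w =
    (frame (i + 1) x \<bullet> v) * (frame (i + 2) x \<bullet> w) - (frame (i + 1) x \<bullet> w) * (frame (i + 2) x \<bullet> v)"
proof -
  have "(x \<bullet> x) * (frame i v \<bullet> w) =
    (frame (i + 1) x \<bullet> v) * (frame (i + 2) x \<bullet> w) - (frame (i + 1) x \<bullet> w) * (frame (i + 2) x \<bullet> v)
    + (x \<bullet> v) * (frame i x \<bullet> w) - (x \<bullet> w) * (frame i x \<bullet> v)"
    using exhaust_3[of i] by (auto simp: inner_4 frame_nth cyclic_3 algebra_simps)
  then show ?thesis using assms by (simp add: S3_iff)
qed

lemma has_derivative_sgn:
  fixes y :: "'a::real_inner"
  assumes "y \<noteq> 0"
  shows "(sgn has_derivative (\<lambda>v. v /\<^sub>R norm y - ((y \<bullet> v) / norm y ^ 3) *\<^sub>R y)) (at y)"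
proof -
  have "((\<lambda>y::'a. inverse (norm y) *\<^sub>R y) has_derivative
     (\<lambda>v. inverse (norm y) *\<^sub>R v + (- (inverse (norm y) * (v \<bullet> sgn y) * inverse (norm y))) *\<^sub>R y)) (at y)"
    using assms by (auto intro!: derivative_eq_intros has_derivative_norm)
  moreover have "(\<lambda>v. inverse (norm y) *\<^sub>R v + (- (inverse (norm y) * (v \<bullet> sgn y) * inverse (norm y))) *\<^sub>R y)
     = (\<lambda>v. v /\<^sub>R norm y - ((y \<bullet> v) / norm y ^ 3) *\<^sub>R y)"
    by (auto simp: sgn_div_norm fun_eq_iff divide_simps power3_eq_cube inner_commute)
  ultimately show ?thesis
    by (simp add: sgn_div_norm[abs_def])
qed

lemma radial_pullback_coform:
  assumes "y \<noteq> 0"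
  shows "radial_pullback (coform i) y v = (frame i y \<bullet> v) / (y \<bullet> y)"
proof -
  let ?w = "v /\<^sub>R norm y - ((y \<bullet> v) / norm y ^ 3) *\<^sub>R y"
  have D: "frechet_derivative sgn (at y) v = ?w"
    using has_derivative_sgn[OF assms] by (simp add: frechet_derivative_at[symmetric])
  have n: "norm y \<noteq> 0" "y \<bullet> y = norm y * norm y" using assms by (auto simp: dot_square_norm power2_eq_square)
  have "(sgn y, ?w) \<in> TS3"
    using n by (simp add: TS3_iff S3_iff sgn_div_norm inner_diff_right divide_simps power3_eq_cube)
  moreover have "y \<bullet> frame i y = 0"
    using frame_skew[of i y y] by (simp add: inner_commute)
  moreover have "frame i (sgn y) = frame i y /\<^sub>R norm y"
    by (simp add: sgn_div_norm linear_frame linear_cmul)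
  ultimately show ?thesis
    unfolding radial_pullback_def D
    using n by (simp add: coform_tproj inner_diff_right inner_commute divide_simps)
qed

lemma radial_pullback_derivative:
  assumes "x \<in> S3" "x \<bullet> v = 0"
  shows "frechet_derivative (\<lambda>y. radial_pullback (coform i) y w) (at x) v = frame i v \<bullet> w"
proof -
  have x: "x \<noteq> 0" "x \<bullet> x = 1" using assms by (auto simp: S3_iff)
  have "((\<lambda>y. (frame i y \<bullet> w) / (y \<bullet> y)) has_derivative
      (\<lambda>u. (frame i u \<bullet> w) - (frame i x \<bullet> w) * (2 * (x \<bullet> u)))) (at x)"
    using x by (auto intro!: derivative_eq_intros
        linear_imp_has_derivative[OF linear_frame] simp: fun_eq_iff inner_commute)
  then have "((\<lambda>y. radial_pullback (coform i) y w) has_derivative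
      (\<lambda>u. (frame i u \<bullet> w) - (frame i x \<bullet> w) * (2 * (x \<bullet> u)))) (at x)"
    by (rule has_derivative_transform_within_open[where s="- {0}"])
       (use x in \<open>auto simp: radial_pullback_coform\<close>)
  then show ?thesis
    using assms(2) by (simp add: frechet_derivative_at[symmetric])
qed

lemma ext_deriv_coform:
  assumes "p \<in> RP3" "X \<in> tangent_space p" "Y \<in> tangent_space p"
  shows "ext_deriv (coform i) X Y = 2 * wedge11 (coform (i + 1)) (coform (i + 2)) X Y"
proof -
  obtain x where x: "x \<in> S3" "p = proj x"
    using assms(1) by (auto simp: RP3_def quotient_def proj_def)
  then obtain v w where vw: "x \<bullet> v = 0" "x \<bullet> w = 0" "X = tproj x v" "Y = tproj x w"
    using assms tangent_space_proj by auto
  then have T: "(x, v) \<in> TS3" "(x, w) \<in> TS3" using x by (auto simp: TS3_iff)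
  let ?d = "euclid_ext_deriv (radial_pullback (coform i))"
  have d: "?d z u u' = 2 * (frame i u \<bullet> u')"
    if "z \<in> S3" "z \<bullet> u = 0" "z \<bullet> u' = 0" for z u u'
    using that frame_skew[of i u' u]
    by (simp add: euclid_ext_deriv_def radial_pullback_derivative inner_commute)
  have "ext_deriv (coform i) X Y = 2 * (frame i v \<bullet> w)"
    unfolding ext_deriv_def vw
    using descend2_tproj[OF T, of ?d] d[of x v w] d[of "- x" "- v" "- w"] x vw
    by (simp add: S3_minus frame_minus)
  then show ?thesis
    using frame_wedge[OF x(1) vw(1,2), of i] T vw by (simp add: wedge11_def coform_tproj)
qed

lemma hodge_coframe:
  assumes "A1 t \<noteq> 0" "A2 t \<noteq> 0" "p \<in> RP3" "X \<in> tangent_space p"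
  shows "hodge (coframe A1 A2 t) (coframe A1 A2 t i) X Y =
    wedge11 (coframe A1 A2 t (i + 1)) (coframe A1 A2 t (i + 2)) X Y"
proof -
  obtain x where x: "x \<in> S3" "p = proj x"
    using assms(3) by (auto simp: RP3_def quotient_def proj_def)
  have p: "fst ` X = p" using assms(4) by (simp add: tangent_space_def)
  let ?e = "coframe A1 A2 t"
  have "(THE c :: real ^ 3. \<forall>Z\<in>tangent_space p. ?e i Z = (\<Sum>j\<in>UNIV. c $ j * ?e j Z)) = axis i 1"
  proof (rule the_equality)
    show "\<forall>Z\<in>tangent_space p. ?e i Z = (\<Sum>j\<in>UNIV. axis i 1 $ j * ?e j Z)"
      by (simp add: axis_def if_distrib[of "\<lambda>x. x * _"] cong: if_cong)
  next
    fix c :: "real ^ 3"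
    assume c: "\<forall>Z\<in>tangent_space p. ?e i Z = (\<Sum>j\<in>UNIV. c $ j * ?e j Z)"
    have "c $ k = axis i 1 $ k" for k
    proof -
      have Z: "(x, frame k x) \<in> TS3" using x by (simp add: TS3_iff frame_orthonormal)
      have e: "?e j (tproj x (frame k x)) = (if j = k then (if k = 1 then A1 t else A2 t) else 0)" for j
        using Z x by (simp add: coframe_def coform_tproj frame_orthonormal)
      have "tproj x (frame k x) \<in> tangent_space p"
        using Z x tangent_space_proj by (auto simp: TS3_iff)
      with c have "?e i (tproj x (frame k x)) = (\<Sum>j\<in>UNIV. c $ j * ?e j (tproj x (frame k x)))"
        by blast
      then have "(if i = k then (if k = 1 then A1 t else A2 t) else 0)
          = c $ k * (if k = 1 then A1 t else A2 t)"
        by (simp add: e if_distrib[of "\<lambda>x. _ * x"] cong: if_cong)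
      then show ?thesis using assms(1,2) by (auto simp: axis_def split: if_splits)
    qed
    then show "c = axis i 1" by (simp add: vec_eq_iff)
  qed
  then show ?thesis
    by (simp add: hodge_def p axis_def if_distrib[of "\<lambda>x. x * _"] cong: if_cong)
qed

end

(* The flow of the scaled coframe is the system (A2^2)' = 2 A1, (A1 A2)' = 2 A2, so
   A2^4 - (A1 A2)^2 is constant. With A1 = 0 and A2 = a at t = 0 the constant is a^4. Hence A2
   increases from a to infinity with A2' = A1 / A2, (A1 / A2)^2 = 1 - (a / A2)^4, and r = A2(t)
   is the radial coordinate of the Eguchi--Hanson metric. *)

theory Submission
  imports Defs
begin

section \<open>Functions of class \<open>C\<^sup>k\<close>\<close>

text \<open>The obstacle is the boundary time \<open>t = 0\<close>: \<open>A1\<close> vanishes there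
  and the flow equation is not imposed, so the initial data act only through continuity. Nor does a
  solution come with signs or smoothness: the flow differentiates only \<open>A2^2\<close> and
  \<open>A1 A2\<close>, and the contact condition says only that \<open>A1\<close> and
  \<open>A2\<close> are nonzero. An arbitrary solution is therefore analysed directly: signs follow
  from the conserved quantity and the initial data, and higher derivatives from the equations
  themselves, by induction on the order. The conserved quantity arises because \<open>A2^4\<close>
  and \<open>(A1 A2)^2\<close> have the same derivative \<open>4 A1 A2^2\<close>. A solution is also
  constructed, so that the claim about all solutions is not vacuous. On the geometric side,
  \<open>differential\<close> is a description over all local lifts and representatives, so every
  lift has to be controlled, although it is determined only up to a sign.\<close>

lemma Ck_on_cong:
  assumes "open W" "Ck_on k W f" "\<And>x. x \<in> W \<Longrightarrow> f x = g x"
  shows "Ck_on k W g"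
  using assms(2,3)
proof (induction k arbitrary: f g)
  case 0
  then show ?case by (simp cong: continuous_on_cong)
next
  case (Suc k)
  have D: "(g has_derivative frechet_derivative f (at x)) (at x)" if x: "x \<in> W" for x
  proof -
    have "f differentiable at x"
      using Suc.prems(1) x assms(1) by (simp add: differentiable_on_eq_differentiable_at)
    then have "(f has_derivative frechet_derivative f (at x)) (at x)"
      by (simp add: frechet_derivative_works)
    then show ?thesis
      by (rule has_derivative_transform_within_open[OF _ assms(1) x Suc.prems(2)])
  qed
  then have "g differentiable_on W"
    using assms(1) by (auto simp: differentiable_on_eq_differentiable_at differentiable_def)
  moreover have "Ck_on k W (\<lambda>x. frechet_derivative g (at x) v)" for v
    by (rule Suc.IH[of "\<lambda>x. frechet_derivative f (at x) v"])
       (use Suc.prems(1) frechet_derivative_at[OF D] in auto)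
  ultimately show ?case by simp
qed

text \<open>Uniqueness of derivatives on an open set lets any explicit derivative replace the chosen
  \<open>frechet_derivative\<close> in the definition of \<open>Ck_on\<close>.\<close>

lemma Ck_on_SucI:
  assumes "open W" "\<And>x. x \<in> W \<Longrightarrow> (f has_derivative f' x) (at x)"
    and "\<And>v. Ck_on k W (\<lambda>x. f' x v)"
  shows "Ck_on (Suc k) W f"
proof -
  have "f differentiable_on W"
    using assms(1,2) by (auto simp: differentiable_on_eq_differentiable_at differentiable_def)
  moreover have "Ck_on k W (\<lambda>x. frechet_derivative f (at x) v)" for v
    by (rule Ck_on_cong[OF assms(1) assms(3)[of v]]) (simp add: frechet_derivative_at[OF assms(2)])
  ultimately show ?thesis by simp
qed

lemma Ck_on_has_derivative:
  assumes "open W" "Ck_on (Suc k) W f" "x \<in> W"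
  shows "(f has_derivative frechet_derivative f (at x)) (at x)"
  using assms by (simp add: differentiable_on_eq_differentiable_at frechet_derivative_works)

text \<open>The product and quotient rules leave undifferentiated factors, so the inductions below
  need the functions themselves at the lower order too.\<close>

lemma Ck_on_SucD: "Ck_on (Suc k) W f \<Longrightarrow> Ck_on k W f"
proof (induction k arbitrary: f)
  case 0
  then show ?case by (simp add: differentiable_imp_continuous_on)
next
  case (Suc k)
  have "f differentiable_on W" "\<And>v. Ck_on (Suc k) W (\<lambda>x. frechet_derivative f (at x) v)"
    using Suc.prems unfolding Ck_on.simps(2)[of "Suc k"] by blast+
  then have "f differentiable_on W" "\<And>v. Ck_on k W (\<lambda>x. frechet_derivative f (at x) v)"
    by (blast intro: Suc.IH)+
  then show ?case by simp
qed

lemma Ck_on_const: "open W \<Longrightarrow> Ck_on k W (\<lambda>x. c)"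
proof (induction k arbitrary: c)
  case (Suc k)
  show ?case by (rule Ck_on_SucI[where f'="\<lambda>x v. 0"]) (use Suc in auto)
qed simp

lemma Ck_on_bounded_linear:
  assumes "bounded_linear L" "open W"
  shows "Ck_on k W L"
proof (cases k)
  case (Suc m)
  show ?thesis unfolding Suc
    by (rule Ck_on_SucI[where f'="\<lambda>x. L"])
       (use assms Ck_on_const bounded_linear_imp_has_derivative in auto)
qed (use assms linear_continuous_on in simp)

lemma Ck_on_add:
  assumes "open W" "Ck_on k W f" "Ck_on k W g"
  shows "Ck_on k W (\<lambda>x. f x + g x)"
  using assms(2,3)
proof (induction k arbitrary: f g)
  case 0
  then show ?case by (simp add: continuous_on_add)
next
  case (Suc k)
  show ?case
    by (rule Ck_on_SucI[OF assms(1) has_derivative_add])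
       (use Suc in \<open>auto intro!: Ck_on_has_derivative[OF assms(1)]\<close>)
qed

lemma Ck_on_scaleR:
  assumes "open W" "Ck_on k W f" "Ck_on k W g"
  shows "Ck_on k W (\<lambda>x. f x *\<^sub>R g x)"
  using assms(2,3)
proof (induction k arbitrary: f g)
  case 0
  then show ?case by (simp add: continuous_on_scaleR)
next
  case (Suc k)
  have "Ck_on k W f" "Ck_on k W g"
    using Suc.prems by (blast intro: Ck_on_SucD)+
  then show ?case
    by (intro Ck_on_SucI[OF assms(1) has_derivative_scaleR] Ck_on_add[OF assms(1)])
       (use Suc in \<open>auto intro!: Ck_on_has_derivative[OF assms(1)]\<close>)
qed

lemma Ck_on_mult:
  fixes f g :: "'a::euclidean_space \<Rightarrow> real"
  shows "open W \<Longrightarrow> Ck_on k W f \<Longrightarrow> Ck_on k W g \<Longrightarrow> Ck_on k W (\<lambda>x. f x * g x)"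
  using Ck_on_scaleR[of W k f g] by simp

lemma Ck_on_minus:
  assumes "open W" "Ck_on k W f"
  shows "Ck_on k W (\<lambda>x. - f x)"
  using Ck_on_scaleR[OF assms(1) Ck_on_const[OF assms(1), of _ "- 1"] assms(2)] by simp

lemma Ck_on_inverse:
  fixes f :: "'a::euclidean_space \<Rightarrow> real"
  assumes "open W" "Ck_on k W f" "\<And>x. x \<in> W \<Longrightarrow> f x \<noteq> 0"
  shows "Ck_on k W (\<lambda>x. inverse (f x))"
  using assms(2)
proof (induction k)
  case 0
  then show ?case using assms(3) by (auto intro!: continuous_on_inverse)
next
  case (Suc k)
  have "Ck_on k W f"
    using Suc.prems by (rule Ck_on_SucD)
  have D: "((\<lambda>x. inverse (f x)) has_derivative
      (\<lambda>v. - (inverse (f x) * frechet_derivative f (at x) v * inverse (f x)))) (at x)"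
    if "x \<in> W" for x
    using that assms(3) Ck_on_has_derivative[OF assms(1) Suc.prems]
    by (intro Deriv.has_derivative_inverse)
  show ?case
    by (rule Ck_on_SucI[OF assms(1) D])
       (use Suc \<open>Ck_on k W f\<close> in \<open>auto intro!: Ck_on_minus Ck_on_mult assms(1)\<close>)
qed

lemma Ck_on_divide:
  fixes f g :: "'a::euclidean_space \<Rightarrow> real"
  assumes "open W" "Ck_on k W f" "Ck_on k W g" "\<And>x. x \<in> W \<Longrightarrow> g x \<noteq> 0"
  shows "Ck_on k W (\<lambda>x. f x / g x)"
  using Ck_on_mult[OF assms(1,2) Ck_on_inverse[OF assms(1,3,4)]] by (simp add: divide_inverse)

text \<open>The bootstrapping step for an ODE: if \<open>f'\<close> is expressed through functions
  already known to be of class \<open>Ck\<close>, then \<open>f\<close> gains one order. The dummy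
  second factor is there because lifts are differentiated on
  \<open>real \<times> quat\<close>.\<close>

lemma Ck_on_fst_SucI:
  fixes f :: "real \<Rightarrow> real"
  assumes "open I" "\<And>t. t \<in> I \<Longrightarrow> (f has_real_derivative f' t) (at t)"
    and "Ck_on k (I \<times> (UNIV :: 'b::euclidean_space set)) (\<lambda>z. f' (fst z))"
  shows "Ck_on (Suc k) (I \<times> (UNIV :: 'b set)) (\<lambda>z. f (fst z))"
proof -
  have W: "open (I \<times> (UNIV :: 'b set))"
    using assms(1) by (intro open_Times) auto
  have D: "((\<lambda>z::real \<times> 'b. f (fst z)) has_derivative (\<lambda>v. f' (fst z) * fst v)) (at z)"
    if "z \<in> I \<times> UNIV" for z
  proof -
    have "(f has_derivative (*) (f' (fst z))) (at (fst z))"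
      using that assms(2) by (auto simp: has_field_derivative_def)
    from has_derivative_compose[OF has_derivative_fst[OF has_derivative_ident] this]
    show ?thesis by simp
  qed
  show ?thesis
    by (rule Ck_on_SucI[OF W D]) (auto intro!: Ck_on_mult Ck_on_const W assms(3))
qed

section \<open>The flow equations\<close>

lemma RP3_proj: "x \<in> S3 \<Longrightarrow> proj x \<in> RP3"
  by (auto simp: RP3_def proj_def quotient_def)

lemma RP3_cases:
  assumes "p \<in> RP3"
  obtains x where "x \<in> S3" "p = proj x"
  using assms by (auto simp: RP3_def quotient_def proj_def)

lemma tangent_space_RP3_cases:
  assumes "p \<in> RP3" "X \<in> tangent_space p"
  obtains x v where "(x, v) \<in> TS3" "X = tproj x v" "p = proj x"
  using assms by (auto elim!: RP3_cases simp: tangent_space_proj TS3_iff)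

lemma frame_tangent:
  assumes "x \<in> S3"
  shows "(x, frame i x) \<in> TS3" "tproj x (frame i x) \<in> tangent_space (proj x)"
  using assms by (auto simp: TS3_iff frame_orthonormal tangent_space_proj)

lemma coform_frame:
  "x \<in> S3 \<Longrightarrow> coform i (tproj x (frame j x)) = (if i = j then 1 else 0)"
  by (simp add: coform_tproj frame_tangent frame_orthonormal)

lemma index_3_neq: "(i::3) + 1 \<noteq> i" "i + 2 \<noteq> i" "i + 2 \<noteq> i + 1" "i + 1 \<noteq> i + 2"
    "i \<noteq> i + 1" "i \<noteq> i + 2"
  using exhaust_3[of i] by auto

text \<open>A constant may be pulled out of \<open>frechet_derivative\<close> only where the
  function is differentiable; near the sphere this is seen from the explicit quotient in
  \<open>radial_pullback_coform\<close>.\<close>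

lemma ext_deriv_scaled_coform:
  assumes "p \<in> RP3" "X \<in> tangent_space p" "Y \<in> tangent_space p"
  shows "ext_deriv (\<lambda>X. c * coform i X) X Y
    = 2 * c * wedge11 (coform (i + 1)) (coform (i + 2)) X Y"
proof -
  obtain x where x: "x \<in> S3" "p = proj x"
    using assms(1) by (rule RP3_cases)
  then obtain v w where vw: "x \<bullet> v = 0" "x \<bullet> w = 0" "X = tproj x v" "Y = tproj x w"
    using assms tangent_space_proj by auto
  then have T: "(x, v) \<in> TS3" "(x, w) \<in> TS3" using x by (auto simp: TS3_iff)
  let ?\<eta> = "radial_pullback (coform i)"
  have diff: "(\<lambda>y. ?\<eta> y u) differentiable (at z)" if "z \<in> S3" for z u
  proof -
    have z: "z \<noteq> 0" using that by (auto simp: S3_iff)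
    have "(\<lambda>y. (frame i y \<bullet> u) / (y \<bullet> y)) differentiable (at z)"
      using z linear_imp_has_derivative[OF linear_frame[of i], of "at z"]
      by (intro differentiable_divide differentiable_inner) (auto simp: differentiable_def)
    then obtain D where "((\<lambda>y. (frame i y \<bullet> u) / (y \<bullet> y)) has_derivative D) (at z)"
      by (auto simp: differentiable_def)
    then have "((\<lambda>y. ?\<eta> y u) has_derivative D) (at z)"
      by (rule has_derivative_transform_within_open[where s="- {0}"])
         (use z in \<open>auto simp: radial_pullback_coform\<close>)
    then show ?thesis by (auto simp: differentiable_def)
  qed
  have pull: "radial_pullback (\<lambda>X. c * coform i X) = (\<lambda>y u. c * ?\<eta> y u)"
    by (simp add: radial_pullback_def fun_eq_iff)
  have scale: "frechet_derivative (\<lambda>y. c * ?\<eta> y u) (at z) u' =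
      c * frechet_derivative (\<lambda>y. ?\<eta> y u) (at z) u'" if "z \<in> S3" for z u u'
    using frechet_derivative_at[OF has_derivative_mult_right[OF
        diff[OF that, of u, unfolded frechet_derivative_works], of c]]
    by metis
  have d: "euclid_ext_deriv (\<lambda>y u. c * ?\<eta> y u) z u u' = c * euclid_ext_deriv ?\<eta> z u u'"
    if "z \<in> S3" for z u u'
    by (simp add: euclid_ext_deriv_def scale[OF that] right_diff_distrib)
  have e: "euclid_ext_deriv ?\<eta> z u u' = 2 * (frame i u \<bullet> u')"
    if "z \<in> S3" "z \<bullet> u = 0" "z \<bullet> u' = 0" for z u u'
    using that frame_skew[of i u' u]
    by (simp add: euclid_ext_deriv_def radial_pullback_derivative inner_commute)
  have "ext_deriv (\<lambda>X. c * coform i X) X Y = c * (2 * (frame i v \<bullet> w))"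
    unfolding ext_deriv_def vw pull
    by (subst descend2_tproj[OF T]) (use x vw in \<open>simp_all add: d e S3_minus frame_minus\<close>)
  then show ?thesis
    using frame_wedge[OF x(1) vw(1,2), of i] T vw by (simp add: wedge11_def coform_tproj)
qed

text \<open>Isolates the dependence on time, so that each form of the coframe is a scalar function
  of time multiplying a fixed form.\<close>

definition scale_factor :: "(real \<Rightarrow> real) \<Rightarrow> (real \<Rightarrow> real) \<Rightarrow> 3 \<Rightarrow> real \<Rightarrow> real" where
  "scale_factor A1 A2 i t = (if i = 1 then A1 t else A2 t)"

lemma coframe_eq: "coframe A1 A2 t i = (\<lambda>X. scale_factor A1 A2 i t * coform i X)"
  by (simp add: coframe_def scale_factor_def fun_eq_iff)

text \<open>The 3-form in question takes the value \<open>2 c^2\<close> on the frame fields in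
  cyclic order starting at \<open>i\<close>. Conversely, a single point of the projective space
  already shows that \<open>c = 0\<close> is excluded.\<close>

lemma contact_form_scaled_coform: "contact_form (\<lambda>X. c * coform i X) \<longleftrightarrow> c \<noteq> 0"
proof
  assume contact: "contact_form (\<lambda>X. c * coform i X)"
  have "proj (axis 1 1) \<in> RP3"
    by (rule RP3_proj) (simp add: S3_def)
  with contact obtain X Y Z where
    "wedge12 (\<lambda>X. c * coform i X) (ext_deriv (\<lambda>X. c * coform i X)) X Y Z \<noteq> 0"
    unfolding contact_form_def by blast
  then show "c \<noteq> 0" by (auto simp: wedge12_def)
next
  assume c: "c \<noteq> 0"
  show "contact_form (\<lambda>X. c * coform i X)"
    unfolding contact_form_def
  proof
    fix p assume "p \<in> RP3"
    then obtain x where x: "x \<in> S3" "p = proj x" by (rule RP3_cases)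
    let ?E = "\<lambda>j. tproj x (frame j x)"
    have E: "?E j \<in> tangent_space p" for j
      using x frame_tangent by simp
    have w: "wedge12 (\<lambda>X. c * coform i X) (ext_deriv (\<lambda>X. c * coform i X))
        (?E i) (?E (i + 1)) (?E (i + 2)) = 2 * c\<^sup>2"
      using x index_3_neq[of i]
      by (simp add: wedge12_def ext_deriv_scaled_coform[OF \<open>p \<in> RP3\<close> E E] wedge11_def
          coform_frame power2_eq_square)
    show "\<exists>X\<in>tangent_space p. \<exists>Y\<in>tangent_space p. \<exists>Z\<in>tangent_space p.
        wedge12 (\<lambda>X. c * coform i X) (ext_deriv (\<lambda>X. c * coform i X)) X Y Z \<noteq> 0"
      by (intro bexI[OF _ E[of i]] bexI[OF _ E[of "i + 1"]] bexI[OF _ E[of "i + 2"]])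
         (use c w in simp)
  qed
qed

text \<open>The 2-forms \<open>wedge11 (coform (i + 1)) (coform (i + 2))\<close> do not depend on
  time, so the flow compares coefficients: the product of the other two scale factors has derivative
  twice the \<open>i\<close>-th one. The equations for \<open>i = 2\<close> and \<open>i = 3\<close>
  coincide, which leaves two.\<close>

lemma contact_flow_iff:
  assumes "open T"
  shows "contact_flow T A1 A2 \<longleftrightarrow> (\<forall>t\<in>T. A1 t \<noteq> 0 \<and> A2 t \<noteq> 0 \<and>
     ((\<lambda>s. (A2 s)\<^sup>2) has_real_derivative 2 * A1 t) (at t) \<and>
     ((\<lambda>s. A1 s * A2 s) has_real_derivative 2 * A2 t) (at t))"
proof -
  let ?f = "scale_factor A1 A2"
  let ?w = "\<lambda>i. wedge11 (coform (i + 1)) (coform (i + 2))"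
  have contact: "(\<forall>i. contact_form (coframe A1 A2 t i)) \<longleftrightarrow> A1 t \<noteq> 0 \<and> A2 t \<noteq> 0" for t
    by (auto simp: coframe_eq contact_form_scaled_coform forall_3 scale_factor_def)
  have hodge: "((\<lambda>s. hodge (coframe A1 A2 s) (coframe A1 A2 s i) X Y) has_real_derivative
         ext_deriv (coframe A1 A2 t i) X Y) (at t) \<longleftrightarrow>
      ((\<lambda>s. ?f (i + 1) s * ?f (i + 2) s * ?w i X Y) has_real_derivative
         2 * ?f i t * ?w i X Y) (at t)"
    if nz: "\<And>s. s \<in> T \<Longrightarrow> A1 s \<noteq> 0 \<and> A2 s \<noteq> 0" and "t \<in> T"
      and X: "p \<in> RP3" "X \<in> tangent_space p" "Y \<in> tangent_space p" for t p i X Y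
  proof (rule DERIV_cong_ev)
    \<comment> \<open>The formula \<open>hodge_coframe\<close> requires nonzero coefficients;
      openness of \<open>T\<close> provides them at all times near \<open>t\<close>, as the
      derivative demands.\<close>
    have "\<forall>\<^sub>F s in nhds t. s \<in> T"
      using assms \<open>t \<in> T\<close> by (rule eventually_nhds_in_open)
    then show "\<forall>\<^sub>F s in nhds t. hodge (coframe A1 A2 s) (coframe A1 A2 s i) X Y =
        ?f (i + 1) s * ?f (i + 2) s * ?w i X Y"
    proof eventually_elim
      case (elim s)
      then show ?case
        using hodge_coframe[of A1 s A2 p X i Y] nz[OF elim] X
        by (simp add: coframe_eq wedge11_def algebra_simps)
    qed
  qed (use X in \<open>auto simp: coframe_eq ext_deriv_scaled_coform\<close>)
  have derivs: "(\<forall>i. \<forall>p\<in>RP3. \<forall>X\<in>tangent_space p. \<forall>Y\<in>tangent_space p.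
        ((\<lambda>s. hodge (coframe A1 A2 s) (coframe A1 A2 s i) X Y) has_real_derivative
           ext_deriv (coframe A1 A2 t i) X Y) (at t)) \<longleftrightarrow>
      (\<forall>i. ((\<lambda>s. ?f (i + 1) s * ?f (i + 2) s) has_real_derivative 2 * ?f i t) (at t))"
      (is "?L \<longleftrightarrow> ?R")
    if nz: "\<And>s. s \<in> T \<Longrightarrow> A1 s \<noteq> 0 \<and> A2 s \<noteq> 0" and t: "t \<in> T" for t
  proof
    assume L: ?L
    show ?R
    proof
      fix i
      define x :: quat where "x = axis 1 1"
      have x: "x \<in> S3" by (simp add: x_def S3_def)
      let ?X = "tproj x (frame (i + 1) x)" and ?Y = "tproj x (frame (i + 2) x)"
      have XY: "?X \<in> tangent_space (proj x)" "?Y \<in> tangent_space (proj x)"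
        using frame_tangent[OF x] by auto
      \<comment> \<open>Evaluation on this pair of frame vectors reads off the coefficient.\<close>
      have "?w i ?X ?Y = 1"
        using x index_3_neq[of i] by (simp add: wedge11_def coform_frame)
      then show "((\<lambda>s. ?f (i + 1) s * ?f (i + 2) s) has_real_derivative 2 * ?f i t) (at t)"
        using L[rule_format, OF RP3_proj[OF x] XY, of i]
          hodge[OF nz t RP3_proj[OF x] XY, of i] by simp
    qed
  next
    assume R: ?R
    show ?L
      using hodge[OF nz t] DERIV_cmult_right[OF R[rule_format]] by blast
  qed
  have sys: "(\<forall>i. ((\<lambda>s. ?f (i + 1) s * ?f (i + 2) s) has_real_derivative 2 * ?f i t) (at t)) \<longleftrightarrow>
     ((\<lambda>s. (A2 s)\<^sup>2) has_real_derivative 2 * A1 t) (at t) \<and>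
     ((\<lambda>s. A1 s * A2 s) has_real_derivative 2 * A2 t) (at t)" for t
    by (auto simp: forall_3 scale_factor_def cyclic_3 power2_eq_square mult.commute)
  show ?thesis
  proof (cases "\<forall>t\<in>T. A1 t \<noteq> 0 \<and> A2 t \<noteq> 0")
    case True
    then show ?thesis
      unfolding contact_flow_def all_conj_distrib using contact derivs sys by auto
  next
    case False
    then show ?thesis
      unfolding contact_flow_def all_conj_distrib using contact by auto
  qed
qed

section \<open>Existence of a solution with initial data \<open>(0, a)\<close>\<close>

text \<open>Monotonicity and the intermediate value theorem give the inverse, and the inverse
  function theorem its derivative. At the endpoint \<open>c\<close> only continuity is assumed,
  because the lemma also inverts \<open>A2\<close>, whose equation is known only for
  \<open>t > 0\<close>.\<close>

lemma increasing_inverse: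
  fixes f f' :: "real \<Rightarrow> real"
  assumes cont: "continuous_on {c..} f"
    and deriv: "\<And>t. t > c \<Longrightarrow> (f has_real_derivative f' t) (at t)"
    and pos: "\<And>t. t > c \<Longrightarrow> f' t > 0"
    and unbounded: "\<And>y. \<exists>t>c. f t > y"
  obtains g where "\<And>t. t > c \<Longrightarrow> f t > f c \<and> g (f t) = t"
    and "\<And>y. y > f c \<Longrightarrow> g y > c \<and> f (g y) = y"
    and "\<And>y. y > f c \<Longrightarrow> (g has_real_derivative inverse (f' (g y))) (at y)"
proof -
  have mono: "f s < f t" if "c \<le> s" "s < t" for s t
  proof (rule DERIV_pos_imp_increasing_open[OF \<open>s < t\<close>, where f=f])
    show "\<exists>y. (f has_real_derivative y) (at u) \<and> y > 0" if "s < u" "u < t" for u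
      using that \<open>c \<le> s\<close> deriv[of u] pos[of u] by auto
    show "continuous_on {s..t} f"
      using cont by (rule continuous_on_subset) (use that in auto)
  qed
  have inj: "inj_on f {c<..}"
    by (rule linorder_inj_onI) (auto simp: mono less_imp_le less_imp_neq)
  have surj: "y \<in> f ` {c<..}" if y: "y > f c" for y
  proof -
    obtain t where t: "t > c" "f t > y" using unbounded by blast
    have "continuous_on {c..t} f"
      using cont by (rule continuous_on_subset) auto
    with t y obtain s where "s \<ge> c" "f s = y"
      using IVT'[of f c y t] by auto
    with y show ?thesis by (cases "s = c") auto
  qed
  define g where "g = inv_into {c<..} f"
  have gf: "g (f t) = t" if "t > c" for t
    using that inj by (simp add: g_def)
  have fg: "g y > c \<and> f (g y) = y" if "y > f c" for y
    using inv_into_into[OF surj[OF that]] f_inv_into_f[OF surj[OF that]] by (simp add: g_def)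
  have "(g has_real_derivative inverse (f' (g y))) (at y)" if "y > f c" for y
    unfolding has_field_derivative_def
  proof (rule has_derivative_inverse_strong_x[where S="{c<..}"])
    show "(f has_derivative (*) (f' (g y))) (at (g y))"
      using deriv[of "g y"] fg[OF that] by (simp add: has_field_derivative_def)
    show "continuous_on {c<..} f"
      using cont by (rule continuous_on_subset) auto
    show "(*) (f' (g y)) \<circ> (*) (inverse (f' (g y))) = id"
      using pos[of "g y"] fg[OF that] by (auto simp: fun_eq_iff)
  qed (use fg[OF that] gf in auto)
  then show ?thesis
    using that[of g] gf fg mono by auto
qed

text \<open>The product \<open>\<phi> = A\<^sub>1 A\<^sub>2\<close> solves \<open>\<phi>' = 2 (\<phi>\<^sup>2 + a\<^sup>4)\<^bsup>1/4\<^esup>\<close>, whose right-hand side is smooth, whereas the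
  equation for \<open>A\<^sub>2\<close> alone is singular at \<open>A\<^sub>2 = a\<close>.\<close>

lemma flow_solution_exists:
  fixes a :: real
  assumes a: "a > 0"
  shows "\<exists>A1 A2. flow_solution 0 a A1 A2"
proof -
  define q where "q = (\<lambda>s::real. 2 * sqrt (sqrt (s\<^sup>2 + a ^ 4)))"
  have arg: "s\<^sup>2 + a ^ 4 > 0" for s
    using a by (simp add: add_nonneg_pos)
  have q: "q s > 0" for s
    using arg by (simp add: q_def)
  \<comment> \<open>Separation of variables: \<open>T x - T 0\<close> is the time at which the
    solution reaches \<open>x\<close>. Integrating from -2 and inverting beyond -1 makes 0 an
    interior point, so that \<phi> is differentiable at time 0 as well.\<close>
  define T where "T = (\<lambda>x. integral {-2..x} (\<lambda>s. 1 / q s))"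
  have T: "(T has_real_derivative 1 / q x) (at x)" if "x > - 2" for x
  proof -
    have "continuous_on {-2..x + 1} (\<lambda>s. 1 / q s)"
      using q by (intro continuous_intros) (auto simp: q_def less_imp_neq[THEN not_sym] intro!: continuous_intros)
    from integral_has_real_derivative[OF this, of x] show ?thesis
      using that by (simp add: T_def at_within_Icc_at)
  qed
  \<comment> \<open>This excludes blow-up in finite time: \<open>s^2 + a^4 \<le> (s + a^2)^2\<close>
    bounds \<open>1 / q s\<close> below by the derivative of \<open>sqrt (s + a^2)\<close>, so
    \<open>T\<close> is unbounded.\<close>
  have lower: "T x \<ge> T 0 + sqrt (x + a\<^sup>2) - a" if "x \<ge> 0" for x
  proof -
    have "\<exists>y. ((\<lambda>x. T x - sqrt (x + a\<^sup>2)) has_real_derivative y) (at s) \<and> y \<ge> 0" if s: "s \<ge> 0" for s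
    proof (intro exI conjI)
      have p: "s + a\<^sup>2 > 0" using s a by (simp add: add_nonneg_pos)
      show "((\<lambda>x. T x - sqrt (x + a\<^sup>2)) has_real_derivative 1 / q s - inverse (sqrt (s + a\<^sup>2)) / 2) (at s)"
        using p s by (auto intro!: derivative_eq_intros T)
      have "s\<^sup>2 + a ^ 4 \<le> (s + a\<^sup>2)\<^sup>2"
        using s a by (simp add: power2_eq_square algebra_simps power4_eq_xxxx zero_le_mult_iff)
      then have "sqrt (s\<^sup>2 + a ^ 4) \<le> s + a\<^sup>2"
        using p by (intro real_le_lsqrt) auto
      then have "q s \<le> 2 * sqrt (s + a\<^sup>2)" by (simp add: q_def)
      then have "inverse (2 * sqrt (s + a\<^sup>2)) \<le> inverse (q s)"
        using q[of s] by (rule le_imp_inverse_le)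
      then show "1 / q s - inverse (sqrt (s + a\<^sup>2)) / 2 \<ge> 0"
        by (simp add: field_simps)
    qed
    then have "T 0 - sqrt (0 + a\<^sup>2) \<le> T x - sqrt (x + a\<^sup>2)"
      using that by (intro DERIV_nonneg_imp_nondecreasing[of 0 x "\<lambda>x. T x - sqrt (x + a\<^sup>2)"]) auto
    then show ?thesis using a by simp
  qed
  obtain g where g: "\<And>t. t > - 1 \<Longrightarrow> T t > T (- 1) \<and> g (T t) = t"
    "\<And>y. y > T (- 1) \<Longrightarrow> (g has_real_derivative inverse (1 / q (g y))) (at y)"
  proof (rule increasing_inverse[of "- 1" T "\<lambda>x. 1 / q x"])
    show "continuous_on {- 1..} T"
      by (rule DERIV_continuous_on[OF has_field_derivative_at_within[OF T]]) simp
    show "\<exists>t>- 1. T t > y" for y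
    proof -
      define b where "b = \<bar>y\<bar> + a + \<bar>T 0\<bar> + 1"
      have "b > 0" using a by (simp add: b_def)
      then have "b \<le> sqrt (b\<^sup>2 + a\<^sup>2)" by (intro real_le_rsqrt) simp
      then have "T (b\<^sup>2) > y"
        using lower[OF zero_le_power2[of b]] unfolding b_def by linarith
      moreover have "b\<^sup>2 > - 1" by (rule less_le_trans[of _ 0]) auto
      ultimately show ?thesis by blast
    qed
  qed (use T q in auto)
  define \<phi> where "\<phi> t = g (t + T 0)" for t
  have \<phi>0: "\<phi> 0 = 0"
    using g(1)[of 0] by (simp add: \<phi>_def)
  have \<phi>': "(\<phi> has_real_derivative q (\<phi> t)) (at t)" if "t \<ge> 0" for t
  proof -
    have "t + T 0 > T (- 1)" using g(1)[of 0] that by auto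
    then have "(g has_real_derivative q (\<phi> t)) (at (t + T 0))"
      using g(2)[of "t + T 0"] by (simp add: \<phi>_def)
    then show ?thesis
      unfolding \<phi>_def[abs_def] by (simp add: DERIV_shift)
  qed
  have \<phi>_pos: "\<phi> t > 0" if "t > 0" for t
    using DERIV_pos_imp_increasing[of 0 t \<phi>] that \<phi>' q \<phi>0 by fastforce
  \<comment> \<open>Solves the conservation law \<open>A2^4 - \<phi>^2 = a^4\<close> for
    \<open>A2\<close>; then \<open>A1\<close> is recovered from \<phi> =
    \<open>A1 A2\<close>.\<close>
  define A2 where "A2 t = sqrt (sqrt ((\<phi> t)\<^sup>2 + a ^ 4))" for t
  define A1 where "A1 t = \<phi> t / A2 t" for t
  have A2: "A2 t > 0" for t
    using arg by (simp add: A2_def)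
  have A2_sq: "(A2 t)\<^sup>2 = sqrt ((\<phi> t)\<^sup>2 + a ^ 4)" for t
    using arg[of "\<phi> t"] by (simp add: A2_def)
  have c\<phi>: "continuous_on {0..} \<phi>"
    by (rule DERIV_continuous_on[OF has_field_derivative_at_within[OF \<phi>']]) simp
  have cA2: "continuous_on {0..} A2"
    unfolding A2_def[abs_def] by (intro continuous_intros c\<phi>)
  have cA1: "continuous_on {0..} A1"
    unfolding A1_def[abs_def] using A2 by (intro continuous_intros c\<phi> cA2) (auto simp: less_imp_neq[THEN not_sym])
  have "contact_flow {0<..} A1 A2"
    unfolding contact_flow_iff[OF open_greaterThan]
  proof (intro ballI conjI)
    fix t :: real assume "t \<in> {0<..}"
    then have t: "t > 0" by simp
    show "A1 t \<noteq> 0" "A2 t \<noteq> 0"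
      using \<phi>_pos[OF t] A2[of t] by (auto simp: A1_def)
    have "((\<lambda>s. sqrt ((\<phi> s)\<^sup>2 + a ^ 4)) has_real_derivative
        inverse (sqrt ((\<phi> t)\<^sup>2 + a ^ 4)) / 2 * (2 * \<phi> t * q (\<phi> t))) (at t)"
      using t arg[of "\<phi> t"] by (auto intro!: derivative_eq_intros \<phi>')
    moreover have "inverse (sqrt ((\<phi> t)\<^sup>2 + a ^ 4)) / 2 * (2 * \<phi> t * q (\<phi> t)) = 2 * A1 t"
      using A2[of t] unfolding A2_sq[symmetric] q_def A2_def[symmetric] A1_def
      by (simp add: field_simps power2_eq_square)
    ultimately show "((\<lambda>s. (A2 s)\<^sup>2) has_real_derivative 2 * A1 t) (at t)"
      unfolding A2_sq by simp
    have "(\<lambda>s. A1 s * A2 s) = \<phi>"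
      using A2 by (auto simp: A1_def fun_eq_iff less_imp_neq[THEN not_sym])
    then show "((\<lambda>s. A1 s * A2 s) has_real_derivative 2 * A2 t) (at t)"
      using \<phi>'[of t] t by (simp add: q_def A2_def)
  qed
  moreover have "A2 0 = a"
    using a by (simp add: A2_def \<phi>0 real_sqrt_unique[of "a\<^sup>2" "a ^ 4"])
  moreover have "A1 0 = 0" by (simp add: A1_def \<phi>0)
  ultimately show ?thesis
    using cA1 cA2 unfolding flow_solution_def by blast
qed

section \<open>Signs, derivatives and growth of an arbitrary solution\<close>

lemma flow_solution_properties:
  assumes a: "a > 0" and flow: "flow_solution 0 a A1 A2"
  shows flow_A2_pos: "\<And>t. t \<ge> 0 \<Longrightarrow> A2 t > 0"
    and flow_A1_pos: "\<And>t. t > 0 \<Longrightarrow> A1 t > 0"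
    and flow_conserved: "\<And>t. t \<ge> 0 \<Longrightarrow> (A2 t) ^ 4 - (A1 t * A2 t)\<^sup>2 = a ^ 4"
    and flow_A2_deriv: "\<And>t. t > 0 \<Longrightarrow> (A2 has_real_derivative A1 t / A2 t) (at t)"
    and flow_A1_deriv: "\<And>t. t > 0 \<Longrightarrow> (A1 has_real_derivative 2 - (A1 t / A2 t)\<^sup>2) (at t)"
    and flow_A2_unbounded: "\<And>y. \<exists>t>0. A2 t > y"
proof -
  have c: "continuous_on {0..} A1" "continuous_on {0..} A2" and init: "A1 0 = 0" "A2 0 = a"
    and ode: "\<And>t. t > 0 \<Longrightarrow> ((\<lambda>s. (A2 s)\<^sup>2) has_real_derivative 2 * A1 t) (at t)"
      "\<And>t. t > 0 \<Longrightarrow> ((\<lambda>s. A1 s * A2 s) has_real_derivative 2 * A2 t) (at t)"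
    using flow unfolding flow_solution_def contact_flow_iff[OF open_greaterThan] by auto
  have cs: "continuous_on {0..t} A1" "continuous_on {0..t} A2" for t
    using c by (auto elim: continuous_on_subset)
  show cons: "(A2 t) ^ 4 - (A1 t * A2 t)\<^sup>2 = a ^ 4" if "t \<ge> 0" for t
  proof (cases "t = 0")
    case False
    \<comment> \<open>The fourth power is written as a square of \<open>A2^2\<close> because
      \<open>A2\<close> itself is not yet known to be differentiable. Continuity carries the
      constant value down to time 0.\<close>
    define H where "H s = ((A2 s)\<^sup>2)\<^sup>2 - (A1 s * A2 s)\<^sup>2" for s
    have "H t = H 0"
    proof (rule DERIV_isconst_end[where f=H])
      show "0 < t" using False that by simp
      show "continuous_on {0..t} H"
        unfolding H_def[abs_def] by (intro continuous_intros cs)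
      show "(H has_real_derivative 0) (at s)" if "0 < s" "s < t" for s
        unfolding H_def[abs_def]
        by (rule DERIV_cong[OF DERIV_diff[OF DERIV_power[OF ode(1)] DERIV_power[OF ode(2)]]])
           (use that in \<open>simp_all add: power2_eq_square\<close>)
    qed
    then show ?thesis by (simp add: H_def init)
  qed (simp add: init)
  have nz: "A2 t \<noteq> 0" if "t \<ge> 0" for t
    using cons[OF that] a by auto
  \<comment> \<open>The conservation law forbids zeros of \<open>A2\<close>, so the positive sign at
    time 0 persists.\<close>
  show A2_pos: "A2 t > 0" if "t \<ge> 0" for t
  proof (rule ccontr)
    assume "\<not> A2 t > 0"
    then obtain s where "s \<ge> 0" "A2 s = 0"
      using IVT2'[of A2 t 0 0] cs(2) \<open>t \<ge> 0\<close> init a by auto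
    then show False using nz by blast
  qed
  have A2_ge: "A2 t \<ge> a" if "t \<ge> 0" for t
  proof -
    have "a ^ 4 \<le> A2 t ^ 4" using cons[OF that] zero_le_power2[of "A1 t * A2 t"] by linarith
    then show ?thesis
      using A2_pos[OF that] a power_mono_iff[of a "A2 t" 4] by simp
  qed
  \<comment> \<open>Since \<open>A2 \<ge> a\<close>, the product \<open>A1 A2\<close> grows at rate
    at least \<open>2 a\<close>. This settles the sign of \<open>A1\<close> and also drives
    \<open>A2\<close> to infinity.\<close>
  have product: "A1 t * A2 t \<ge> 2 * a * t" if "t \<ge> 0" for t
  proof -
    define h where "h s = A1 s * A2 s - 2 * a * s" for s
    have "h 0 \<le> h t"
    proof (rule DERIV_nonneg_imp_increasing_open[OF that, where f=h])
      show "\<exists>y. (h has_real_derivative y) (at s) \<and> 0 \<le> y" if "0 < s" "s < t" for s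
        unfolding h_def[abs_def]
        using DERIV_diff[OF ode(2)[OF that(1)] DERIV_cmult_Id[of "2 * a" s UNIV]] A2_ge[of s] that(1)
        by (intro exI[of _ "2 * A2 s - 2 * a"] conjI) simp_all
      show "continuous_on {0..t} h"
        unfolding h_def[abs_def] by (intro continuous_intros cs)
    qed
    then show ?thesis by (simp add: h_def init)
  qed
  show A1_pos: "A1 t > 0" if "t > 0" for t
  proof -
    have "0 < 2 * a * t" using a that by simp
    then have "A1 t * A2 t > 0" using product[of t] that by linarith
    then show ?thesis using A2_pos[of t] that by (simp add: zero_less_mult_iff)
  qed
  show A2': "(A2 has_real_derivative A1 t / A2 t) (at t)" if "t > 0" for t
  proof -
    \<comment> \<open>Differentiability of \<open>A2\<close> is recovered by taking the positive
      root of \<open>A2^2\<close>.\<close>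
    have "((\<lambda>s. sqrt ((A2 s)\<^sup>2)) has_real_derivative inverse (sqrt ((A2 t)\<^sup>2)) / 2 * (2 * A1 t)) (at t)"
      using A2_pos[of t] that by (intro DERIV_chain2[OF DERIV_real_sqrt ode(1)]) auto
    then have "((\<lambda>s. sqrt ((A2 s)\<^sup>2)) has_real_derivative A1 t / A2 t) (at t)"
      using A2_pos[of t] that by (simp add: field_simps)
    then show ?thesis
      by (rule has_field_derivative_transform_within_open[where S="{0<..}"])
         (use that A2_pos in \<open>auto simp: less_imp_le\<close>)
  qed
  show "(A1 has_real_derivative 2 - (A1 t / A2 t)\<^sup>2) (at t)" if "t > 0" for t
  proof -
    have "((\<lambda>s. A1 s * A2 s / A2 s) has_real_derivative
        (2 * A2 t * A2 t - A1 t * A2 t * (A1 t / A2 t)) / (A2 t * A2 t)) (at t)"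
      using A2_pos[of t] that by (intro DERIV_divide ode(2) A2') auto
    then have "((\<lambda>s. A1 s * A2 s / A2 s) has_real_derivative 2 - (A1 t / A2 t)\<^sup>2) (at t)"
      using A2_pos[of t] that by (simp add: field_simps power2_eq_square)
    then show ?thesis
      by (rule has_field_derivative_transform_within_open[where S="{0<..}"])
         (use that nz in \<open>auto simp: less_imp_le\<close>)
  qed
  show "\<exists>t>0. A2 t > y" for y
  proof -
    \<comment> \<open>Chosen so that \<open>2 * a * t = y^2 + 1\<close>; then
      \<open>A2^4 \<ge> (A1 A2)^2\<close> yields \<open>A2^2 \<ge> y^2 + 1\<close>.\<close>
    define t where "t = (y\<^sup>2 + 1) / (2 * a)"
    have t: "t > 0" using a by (simp add: t_def add_nonneg_pos)
    have "(y\<^sup>2 + 1)\<^sup>2 \<le> (A1 t * A2 t)\<^sup>2"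
      using product[of t] t a by (intro power_mono) (auto simp: t_def)
    also have "\<dots> \<le> (A2 t) ^ 4"
      using cons[of t] t a zero_le_power[of a 4] by linarith
    finally have "(y\<^sup>2 + 1)\<^sup>2 \<le> ((A2 t)\<^sup>2)\<^sup>2" by simp
    then have "y\<^sup>2 + 1 \<le> (A2 t)\<^sup>2"
      by (rule power2_le_imp_le) simp
    then have "y < A2 t"
      using A2_pos[of t] t by (intro power_less_imp_less_base[of y 2]) auto
    with t show ?thesis by blast
  qed
qed

section \<open>Maps \<open>(t, p) \<mapsto> (f t, p)\<close> and the isometry\<close>

lemma reparam_smooth_map:
  assumes "open I"
    and "\<And>k. Ck_on k (I \<times> (UNIV :: quat set)) (\<lambda>z. f (fst z))"
    and "\<And>t. t \<in> I \<Longrightarrow> f t \<in> J"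
    and "\<And>t p. t \<in> I \<Longrightarrow> p \<in> RP3 \<Longrightarrow> F (t, p) = (f t, p)"
  shows "smooth_map I J F"
  unfolding smooth_map_def
proof
  fix z :: "real \<times> quat"
  assume z: "z \<in> I \<times> S3"
  let ?W = "I \<times> (UNIV :: quat set)"
  \<comment> \<open>The global lift \<open>(t, x) \<mapsto> (f t, x)\<close>, split into a scalar
    multiple of a fixed vector and a linear map so that the closure rules for \<open>Ck_on\<close>
    apply.\<close>
  let ?G = "\<lambda>z::real \<times> quat. f (fst z) *\<^sub>R (1::real, 0) + (0, snd z)"
  have W: "open ?W" using assms(1) by (intro open_Times) auto
  have "bounded_linear (\<lambda>z::real \<times> quat. (0::real, snd z))"
    by (intro bounded_linear_Pair bounded_linear_zero bounded_linear_snd)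
  note lin = Ck_on_bounded_linear[OF this W]
  have "smooth_on ?W ?G"
    unfolding smooth_on_def
    by (intro allI Ck_on_add Ck_on_scaleR W assms(2) Ck_on_const lin)
  moreover have "\<forall>(t, x) \<in> ?W \<inter> (I \<times> S3).
      ?G (t, x) \<in> J \<times> S3 \<and> F (t, proj x) = (fst (?G (t, x)), proj (snd (?G (t, x))))"
    using assms(3,4) RP3_proj by auto
  ultimately have "local_lift I J F ?W ?G"
    using W by (simp only: local_lift_def)
  moreover have "z \<in> ?W" using z by auto
  ultimately show "\<exists>W G. z \<in> W \<and> local_lift I J F W G"
    by (intro exI conjI)
qed

section \<open>The differential of a reparametrisation of the interval\<close>

lemma tproj_cases:
  assumes "(x, v) \<in> TS3" "(y, w) \<in> tproj x v"
  shows "(y, w) \<in> TS3" "tproj y w = tproj x v"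
proof -
  have "(y = x \<and> w = v) \<or> (y = - x \<and> w = - v)"
    using assms by (auto simp: tproj_eq)
  moreover have "(- x, - v) \<in> TS3"
    using assms(1) by (simp add: TS3_iff S3_minus)
  ultimately show "(y, w) \<in> TS3" "tproj y w = tproj x v"
    using assms(1) by (auto simp: tproj_eq)
qed

text \<open>Along the curve \<open>s \<mapsto> (t + s \<tau>, sgn (x + s v))\<close> a local lift is \<open>(f (t + s \<tau>), e sgn (x + s v))\<close>
  with a sign \<open>e\<close> that is constant by continuity.\<close>

lemma local_lift_reparam_derivative:
  fixes \<tau> :: real
  assumes "open I" "t \<in> I"
    and F: "\<And>t p. t \<in> I \<Longrightarrow> p \<in> RP3 \<Longrightarrow> F (t, p) = (f t, p)"
    and f': "(f has_real_derivative f') (at t)"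
    and lift: "local_lift I J F W G" and tx: "(t, x) \<in> W" and xv: "(x, v) \<in> TS3"
  defines "D \<equiv> frechet_derivative G (at (t, x)) (\<tau>, v)"
  shows "fst D = f' * \<tau>" and "tproj (snd (G (t, x))) (snd D) = tproj x v"
proof -
  \<comment> \<open>\<open>G\<close> is differentiated in the ambient space, but the lift condition
    constrains it only on \<open>I \<times> S3\<close>. Normalising keeps the curve on the sphere,
    and its velocity at 0 is still \<open>v\<close> because \<open>v\<close> is tangent.\<close>
  define \<gamma> where "\<gamma> s = sgn (x + s *\<^sub>R v)" for s
  define \<Gamma> where "\<Gamma> s = (t + s * \<tau>, \<gamma> s)" for s
  have x: "norm x = 1" "x \<bullet> x = 1" "x \<noteq> 0" "x \<bullet> v = 0" "x \<in> S3"
    using xv by (auto simp: TS3_iff S3_iff norm_eq_1)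
  have \<gamma>0: "\<gamma> 0 = x" using x by (simp add: \<gamma>_def sgn_div_norm)
  have \<Gamma>0: "\<Gamma> 0 = (t, x)" by (simp add: \<Gamma>_def \<gamma>0)
  have \<gamma>_S3: "\<gamma> s \<in> S3" for s
  proof -
    have "x \<bullet> (x + s *\<^sub>R v) = 1" using x by (simp add: inner_add_right)
    then have "x + s *\<^sub>R v \<noteq> 0" by force
    then show ?thesis by (simp add: \<gamma>_def S3_def norm_sgn)
  qed
  have \<gamma>': "(\<gamma> has_vector_derivative v) (at 0)"
  proof -
    have "((\<lambda>s. x + s *\<^sub>R v) has_derivative (\<lambda>s. s *\<^sub>R v)) (at 0)"
      by (auto intro!: derivative_eq_intros)
    moreover have "(sgn has_derivative (\<lambda>v. v - (x \<bullet> v) *\<^sub>R x)) (at (x + 0 *\<^sub>R v))"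
      using has_derivative_sgn[OF x(3)] x(1) by simp
    ultimately have "((\<lambda>s. sgn (x + s *\<^sub>R v)) has_derivative
        (\<lambda>s. s *\<^sub>R v - (x \<bullet> (s *\<^sub>R v)) *\<^sub>R x)) (at 0)"
      by (rule has_derivative_compose)
    then show ?thesis
      using x(4) by (simp add: has_vector_derivative_def \<gamma>_def[abs_def])
  qed
  have "((\<lambda>s. t + s * \<tau>) has_vector_derivative \<tau>) (at 0)"
    by (auto intro!: derivative_eq_intros simp flip: has_real_derivative_iff_has_vector_derivative)
  then have \<Gamma>': "(\<Gamma> has_vector_derivative (\<tau>, v)) (at 0)"
    unfolding \<Gamma>_def[abs_def] by (intro has_vector_derivative_Pair \<gamma>')
  have W: "open W" "Ck_on (Suc 0) W G"
    using lift by (auto simp: local_lift_def smooth_on_def simp del: Ck_on.simps)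
  then have "(G has_derivative frechet_derivative G (at (t, x))) (at (\<Gamma> 0))"
    unfolding \<Gamma>0 using tx by (intro Ck_on_has_derivative)
  with \<Gamma>' have "((\<lambda>s. G (\<Gamma> s)) has_derivative (\<lambda>s. frechet_derivative G (at (t, x)) (s *\<^sub>R (\<tau>, v)))) (at 0)"
    unfolding has_vector_derivative_def by (rule has_derivative_compose)
  moreover have "linear (frechet_derivative G (at (t, x)))"
    using Ck_on_has_derivative[OF W tx] by (rule has_derivative_linear)
  ultimately have G': "((\<lambda>s. G (\<Gamma> s)) has_vector_derivative D) (at 0)"
    unfolding has_vector_derivative_def D_def by (simp add: linear_cmul del: scaleR_Pair)
  then have G1': "((\<lambda>s. fst (G (\<Gamma> s))) has_vector_derivative fst D) (at 0)"
    and G2': "((\<lambda>s. snd (G (\<Gamma> s))) has_vector_derivative snd D) (at 0)"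
    using bounded_linear.has_vector_derivative[OF bounded_linear_fst]
      bounded_linear.has_vector_derivative[OF bounded_linear_snd] by blast+
  have "isCont \<Gamma> 0"
    using \<Gamma>' by (rule has_vector_derivative_continuous)
  moreover have "open (W \<inter> (I \<times> UNIV))"
    using W(1) assms(1) by (intro open_Int open_Times) auto
  ultimately have in_W: "\<forall>\<^sub>F s in nhds 0. \<Gamma> s \<in> W \<inter> (I \<times> UNIV)"
    using tx assms(2) \<Gamma>0 unfolding continuous_at_open eventually_nhds
    by (metis IntI SigmaI UNIV_I)
  have all: "\<forall>(t, x) \<in> W \<inter> (I \<times> S3).
      G (t, x) \<in> J \<times> S3 \<and> F (t, proj x) = (fst (G (t, x)), proj (snd (G (t, x))))"
    using lift unfolding local_lift_def by (elim conjE)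
  have near: "\<forall>\<^sub>F s in nhds 0. fst (G (\<Gamma> s)) = f (t + s * \<tau>) \<and>
      (snd (G (\<Gamma> s)) = \<gamma> s \<or> snd (G (\<Gamma> s)) = - \<gamma> s)"
    using in_W
  proof eventually_elim
    case (elim s)
    then have s: "\<Gamma> s \<in> W \<inter> (I \<times> S3)" "t + s * \<tau> \<in> I"
      using \<gamma>_S3 by (auto simp: \<Gamma>_def)
    have "G (\<Gamma> s) \<in> J \<times> S3 \<and> F (t + s * \<tau>, proj (\<gamma> s)) = (fst (G (\<Gamma> s)), proj (snd (G (\<Gamma> s))))"
      using bspec[OF all s(1)] by (simp add: \<Gamma>_def)
    then have "snd (G (\<Gamma> s)) \<in> S3" "fst (G (\<Gamma> s)) = f (t + s * \<tau>)"
        "proj (snd (G (\<Gamma> s))) = proj (\<gamma> s)"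
      using F[OF s(2) RP3_proj[OF \<gamma>_S3]] by (auto simp: mem_Times_iff)
    then show ?case
      using \<gamma>_S3 by (auto simp: proj_eq doubleton_eq_iff)
  qed
  have "((\<lambda>s. f (t + s * \<tau>)) has_vector_derivative f' * \<tau>) (at 0)"
  proof -
    have "((\<lambda>s. t + s * \<tau>) has_real_derivative \<tau>) (at 0)"
      by (auto intro!: derivative_eq_intros)
    then show ?thesis
      using DERIV_chain2[of f f' "\<lambda>s. t + s * \<tau>" 0 \<tau> UNIV] f'
      by (simp add: has_real_derivative_iff_has_vector_derivative)
  qed
  moreover have "((\<lambda>s. f (t + s * \<tau>)) has_vector_derivative fst D) (at 0)"
    using G1'
    by (rule iffD1[OF has_vector_derivative_cong_ev, rotated -1])
       (use near eventually_nhds_x_imp_x[OF near] in \<open>auto elim: eventually_mono\<close>)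
  ultimately show "fst D = f' * \<tau>"
    by (rule vector_derivative_unique_at[symmetric])
  \<comment> \<open>The inner product turns the unknown sign into a continuous function; two values
    in {1, -1} at distance less than 1 are equal.\<close>
  define e where "e s = snd (G (\<Gamma> s)) \<bullet> \<gamma> s" for s
  have e: "\<forall>\<^sub>F s in nhds 0. (e s = 1 \<or> e s = - 1) \<and> snd (G (\<Gamma> s)) = e s *\<^sub>R \<gamma> s"
    using near
  proof eventually_elim
    case (elim s)
    then show ?case using \<gamma>_S3[of s] by (auto simp: e_def S3_iff)
  qed
  have "isCont e 0"
    unfolding e_def[abs_def]
    using has_vector_derivative_continuous[OF G2'] has_vector_derivative_continuous[OF \<gamma>']
    by (rule continuous_inner)
  then have "\<forall>\<^sub>F s in at 0. dist (e s) (e 0) < 1"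
    unfolding isCont_def by (rule tendstoD) simp
  then have "\<forall>\<^sub>F s in nhds 0. dist (e s) (e 0) < 1"
    by (simp add: eventually_nhds_conv_at)
  with e have const: "\<forall>\<^sub>F s in nhds 0. snd (G (\<Gamma> s)) = e 0 *\<^sub>R \<gamma> s"
  proof eventually_elim
    case (elim s)
    then show ?case
      using eventually_nhds_x_imp_x[OF e] by (auto simp: dist_real_def)
  qed
  have "((\<lambda>s. e 0 *\<^sub>R \<gamma> s) has_vector_derivative e 0 *\<^sub>R v) (at 0)"
    using bounded_linear.has_vector_derivative[OF bounded_linear_scaleR_right \<gamma>'] .
  moreover have "((\<lambda>s. e 0 *\<^sub>R \<gamma> s) has_vector_derivative snd D) (at 0)"
    using G2'
    by (rule iffD1[OF has_vector_derivative_cong_ev, rotated -1])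
       (use const eventually_nhds_x_imp_x[OF const] in \<open>auto elim: eventually_mono\<close>)
  ultimately have D: "snd D = e 0 *\<^sub>R v"
    by (rule vector_derivative_unique_at[symmetric])
  \<comment> \<open>If the sign is -1, base point and vector change sign together, which gives the
    same element of \<open>TRP3\<close>.\<close>
  have flip: "tproj (- x) (- v) = tproj x v"
    by (rule tproj_cases(2)[OF xv]) (simp add: tproj_eq[OF xv])
  have G: "snd (G (t, x)) = e 0 *\<^sub>R x" and "e 0 = 1 \<or> e 0 = - 1"
    using eventually_nhds_x_imp_x[OF e] by (auto simp: \<Gamma>0 \<gamma>0)
  then show "tproj (snd (G (t, x))) (snd D) = tproj x v"
    unfolding D G
    by (elim disjE) (simp_all only: flip scaleR_one scaleR_minus1_left)
qed

text \<open>The description defining \<open>differential\<close> is well posed here: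
  \<open>smooth_map\<close> supplies a candidate, and \<open>local_lift_reparam_derivative\<close>
  gives the same value for every lift and either representative.\<close>

lemma differential_reparam:
  assumes "open I" "t \<in> I"
    and F: "\<And>t p. t \<in> I \<Longrightarrow> p \<in> RP3 \<Longrightarrow> F (t, p) = (f t, p)"
    and f': "(f has_real_derivative f') (at t)"
    and smooth: "smooth_map I J F"
    and X: "p \<in> RP3" "X \<in> tangent_space p"
  shows "differential I J F t (\<tau>, X) = (f' * \<tau>, X)"
proof -
  obtain x v where xv: "(x, v) \<in> TS3" "X = tproj x v"
    using tangent_space_RP3_cases[OF X] by blast
  have eq: "(fst D, tproj (snd (G (t, y))) (snd D)) = (f' * \<tau>, X)"
    if "local_lift I J F W G" "(t, y) \<in> W" "(y, w) \<in> X" "D = frechet_derivative G (at (t, y)) (\<tau>, w)"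
    for W G y w D
    using local_lift_reparam_derivative[OF assms(1,2) F f' that(1,2) tproj_cases(1)[OF xv(1)], of w, where \<tau>=\<tau>]
      tproj_cases(2)[OF xv(1)] that(3,4) xv(2) by simp
  have X: "(x, v) \<in> X" using xv by (simp add: tproj_eq)
  have "x \<in> S3" using xv(1) by (simp add: TS3_iff)
  then obtain W G where W: "local_lift I J F W G" "(t, x) \<in> W"
    using smooth assms(2) unfolding smooth_map_def by blast
  show ?thesis
    unfolding differential_def prod.case Let_def
  proof (rule the_equality, goal_cases)
    case 1
    show ?case
      by (intro exI conjI, rule W(1), rule W(2), rule X, rule eq[OF W X refl, symmetric])
  next
    case (2 U)
    then show ?case
      by (elim exE conjE) (hypsubst, rule eq, assumption+, rule refl)
  qed
qed

section \<open>The isometry with the Eguchi--Hanson metric\<close>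

lemma flow_solution_isometric:
  assumes a: "a > 0" and flow: "flow_solution 0 a A1 A2"
  shows "isometric {0<..} (flow_metric A1 A2) {a<..} (eguchi_hanson a)"
proof -
  note A2_pos = flow_A2_pos[OF assms] and A1_pos = flow_A1_pos[OF assms]
    and A2' = flow_A2_deriv[OF assms] and A1' = flow_A1_deriv[OF assms]
  have A2_0: "A2 0 = a" and cA2: "continuous_on {0..} A2"
    using flow by (auto simp: flow_solution_def)
  obtain \<rho> where \<rho>: "\<And>t. t > 0 \<Longrightarrow> A2 t > a \<and> \<rho> (A2 t) = t"
    "\<And>r. r > a \<Longrightarrow> \<rho> r > 0 \<and> A2 (\<rho> r) = r"
    "\<And>r. r > a \<Longrightarrow> (\<rho> has_real_derivative inverse (A1 (\<rho> r) / A2 (\<rho> r))) (at r)"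
    using increasing_inverse[OF cA2 A2' _ flow_A2_unbounded[OF assms]] A1_pos A2_pos A2_0
    by (metis divide_pos_pos less_imp_le)
  \<comment> \<open>\<open>A1\<close> as a function of the radius. With it, \<rho> and
    \<open>B\<close> satisfy a closed system whose right-hand sides are rational in \<open>r\<close>
    and \<open>B\<close>, so smoothness of the inverse map is bootstrapped in the same way as that
    of \<open>A1\<close> and \<open>A2\<close>.\<close>
  define B where "B r = A1 (\<rho> r)" for r
  have B_pos: "B r > 0" if "r > a" for r
    using \<rho>(2)[OF that] A1_pos by (simp add: B_def)
  have \<rho>': "(\<rho> has_real_derivative r / B r) (at r)" if "r > a" for r
    using \<rho>(3)[OF that] \<rho>(2)[OF that] by (simp add: B_def)
  have B': "(B has_real_derivative (2 - (B r / r)\<^sup>2) * (r / B r)) (at r)" if "r > a" for r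
    using DERIV_chain2[OF A1' \<rho>'[OF that]] \<rho>(2)[OF that] by (simp add: B_def[abs_def])
  have A2_nz: "A2 t \<noteq> 0" if "t > 0" for t
    using A2_pos[of t] that by simp
  have B_nz: "B r \<noteq> 0" if "r > a" for r
    using B_pos[OF that] by simp
  have open_W: "open ({c<..} \<times> (UNIV :: quat set))" for c :: real
    by (intro open_Times) auto
  have C_fst: "Ck_on k ({c<..} \<times> (UNIV :: quat set)) fst" for k and c :: real
    by (intro Ck_on_bounded_linear bounded_linear_fst open_W)
  have C_zero: "Ck_on 0 ({c<..} \<times> (UNIV :: quat set)) (\<lambda>z. h (fst z))"
    if "\<And>t. t > c \<Longrightarrow> (h has_real_derivative h' t) (at t)" for c :: real and h h'
  proof -
    have "continuous_on {c<..} h"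
      by (rule DERIV_continuous_on[OF has_field_derivative_at_within[OF that]]) simp
    then show ?thesis
      unfolding Ck_on.simps by (rule continuous_on_compose2) (auto intro: continuous_intros)
  qed
  \<comment> \<open>The equations are coupled, so both functions gain an order in the same induction
    step.\<close>
  have C_A: "Ck_on k ({0<..} \<times> (UNIV :: quat set)) (\<lambda>z. A1 (fst z)) \<and>
      Ck_on k ({0<..} \<times> (UNIV :: quat set)) (\<lambda>z. A2 (fst z))" for k
  proof (induction k)
    case 0
    show ?case using C_zero[OF A1'] C_zero[OF A2'] by blast
  next
    case (Suc k)
    have "Ck_on k ({0<..} \<times> (UNIV :: quat set)) (\<lambda>z. A1 (fst z) / A2 (fst z))"
      by (rule Ck_on_divide[OF open_W]) (use Suc A2_nz in auto)
    moreover from this have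
      "Ck_on k ({0<..} \<times> (UNIV :: quat set)) (\<lambda>z. 2 + - ((A1 (fst z) / A2 (fst z)) * (A1 (fst z) / A2 (fst z))))"
      by (intro Ck_on_add Ck_on_minus Ck_on_mult Ck_on_const open_W)
    ultimately show ?case
      by (intro conjI Ck_on_fst_SucI[OF open_greaterThan A1'] Ck_on_fst_SucI[OF open_greaterThan A2'])
         (auto simp: power2_eq_square)
  qed
  have C_B: "Ck_on k ({a<..} \<times> (UNIV :: quat set)) (\<lambda>z. B (fst z)) \<and>
      Ck_on k ({a<..} \<times> (UNIV :: quat set)) (\<lambda>z. \<rho> (fst z))" for k
  proof (induction k)
    case 0
    show ?case using C_zero[OF B'] C_zero[OF \<rho>'] by blast
  next
    case (Suc k)
    have 1: "Ck_on k ({a<..} \<times> (UNIV :: quat set)) (\<lambda>z. B (fst z) / fst z)"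
      by (rule Ck_on_divide[OF open_W _ C_fst]) (use Suc a in auto)
    have 2: "Ck_on k ({a<..} \<times> (UNIV :: quat set)) (\<lambda>z. fst z / B (fst z))"
      by (rule Ck_on_divide[OF open_W C_fst]) (use Suc B_nz in auto)
    from 1 2 have "Ck_on k ({a<..} \<times> (UNIV :: quat set))
        (\<lambda>z. (2 + - ((B (fst z) / fst z) * (B (fst z) / fst z))) * (fst z / B (fst z)))"
      by (intro Ck_on_add Ck_on_minus Ck_on_mult Ck_on_const open_W)
    with 2 show ?case
      by (intro conjI Ck_on_fst_SucI[OF open_greaterThan B'] Ck_on_fst_SucI[OF open_greaterThan \<rho>'])
         (auto simp: power2_eq_square)
  qed
  define F :: "real \<times> quat set \<Rightarrow> real \<times> quat set" where "F = (\<lambda>(t, p). (A2 t, p))"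
  have bij: "bij_betw F ({0<..} \<times> RP3) ({a<..} \<times> RP3)"
    by (rule bij_betwI[where g="\<lambda>(r, p). (\<rho> r, p)"]) (use \<rho>(1,2) in \<open>auto simp: F_def\<close>)
  have inv: "the_inv_into ({0<..} \<times> RP3) F (r, p) = (\<rho> r, p)" if "r \<in> {a<..}" "p \<in> RP3" for r p
    using that \<rho>(2)[of r] by (intro the_inv_into_f_eq bij_betw_imp_inj_on[OF bij]) (auto simp: F_def)
  have smooth: "smooth_map {0<..} {a<..} F"
    by (rule reparam_smooth_map[of _ A2]) (use C_A \<rho>(1) in \<open>auto simp: F_def\<close>)
  have "smooth_map {a<..} {0<..} (the_inv_into ({0<..} \<times> RP3) F)"
    by (rule reparam_smooth_map[of _ \<rho>]) (use C_B \<rho>(2) inv in auto)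
  with bij smooth have "diffeomorphism {0<..} {a<..} F"
    by (simp add: diffeomorphism_def)
  moreover have "eguchi_hanson a (fst (F (t, p))) (differential {0<..} {a<..} F t (\<tau>, X))
      (differential {0<..} {a<..} F t (\<sigma>, Y)) = flow_metric A1 A2 t (\<tau>, X) (\<sigma>, Y)"
    if t: "t \<in> {0<..}" and p: "p \<in> RP3" "X \<in> tangent_space p" "Y \<in> tangent_space p"
    for t p X Y \<tau> \<sigma>
  proof -
    have diff: "differential {0<..} {a<..} F t (\<tau>, X) = (A1 t / A2 t * \<tau>, X)"
      if "X \<in> tangent_space p" for \<tau> X
      by (rule differential_reparam[where f=A2 and p=p, OF open_greaterThan t])
         (use t p(1) that smooth A2' in \<open>auto simp: F_def\<close>)
    have fst_F: "fst (F (t, p)) = A2 t" by (simp add: F_def)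
    have pos: "A1 t > 0" "A2 t > 0" using t A1_pos A2_pos by auto
    \<comment> \<open>The Eguchi--Hanson factor at \<open>r = A2 t\<close>. The conservation law
      gives \<open>A2^2 * Q = A1^2\<close>, which matches the coefficient of
      \<open>coform 1\<close>, and hence \<open>Q = (A1 / A2)^2\<close>, which cancels the square of
      the radial velocity.\<close>
    define Q where "Q = 1 - (a / A2 t) ^ 4"
    have "(A2 t) ^ 4 * Q = (A1 t * A2 t)\<^sup>2"
      using flow_conserved[OF assms, of t] t pos by (simp add: Q_def right_diff_distrib power_divide)
    then have "(A2 t)\<^sup>2 * ((A2 t)\<^sup>2 * Q) = (A2 t)\<^sup>2 * (A1 t)\<^sup>2"
      by (simp add: power_mult_distrib power4_eq_xxxx power2_eq_square ac_simps)
    then have Q: "(A2 t)\<^sup>2 * Q = (A1 t)\<^sup>2"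
      by (rule mult_left_cancel[THEN iffD1, rotated]) (use pos in simp)
    then have "Q = (A1 t / A2 t)\<^sup>2"
      using pos by (simp add: power_divide eq_divide_eq mult.commute)
    then have \<tau>\<sigma>: "inverse Q * (A1 t / A2 t * \<tau> * (A1 t / A2 t * \<sigma>)) = \<tau> * \<sigma>"
      using pos by (simp add: power2_eq_square)
    show ?thesis
      unfolding diff[OF p(2)] diff[OF p(3)] eguchi_hanson_def flow_metric_def RP3_metric_def
        fst_F prod.case Q_def[symmetric] \<tau>\<sigma> Q
      by simp
  qed
  ultimately show ?thesis
    unfolding isometric_def by blast
qed

theorem theorem3:
  fixes a :: real
  assumes "a > 0"
  shows "\<exists>c1 c2.
    (\<exists>A1 A2. flow_solution c1 c2 A1 A2) \<and>
    (\<forall>A1 A2. flow_solution c1 c2 A1 A2 \<longrightarrow>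
       isometric {0<..} (flow_metric A1 A2) {a<..} (eguchi_hanson a))"
  using flow_solution_exists[OF assms] flow_solution_isometric[OF assms] by blast

end
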